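(* Let $B$ be a finite connected graph of positive order without half-loops. Let $\Psi$ be a finite collection of connected, pruned $B$-graphs, each of order at least one, and let $I_\Psi(G)$ be $1$ if $G$ has a subgraph isomorphic (as a $B$-graph) to an element of $\Psi$ and $0$ otherwise. Then for every positive integer $r$ there are constants $p_1,\dots,p_{r-1}$ such that $$\mathbb E_{G\in\mathcal C_n(B)}[I_\Psi(G)]=p_1n^{-1}+p_2n^{-2}+\cdots+p_{r-1}n^{1-r}+O(n^{-r}).$$
   Context: Graphs are finite, multiple edges and whole-loops allowed, no half-loops; $\mathrm{ord}(\psi)=|E_\psi|-|V_\psi|$ ($E$ undirected edges); pruned means every vertex has degree at least two. A $B$-graph is a graph with a morphism to $B$; graphs of $\mathcal C_n(B)$ are $B$-graphs via their covering map. $\mathcal C_n(B)$: random cover with vertex set $V_B\times[n]$ from independent uniform permutations $\sigma(e)\in S_n$, one per undirected edge ($\sigma(e^{-1})=\sigma(e)^{-1}$), the edge over $e$ with tail $(t(e),i)$ having head $(h(e),\sigma(e)i)$. *)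

theory Defs
  imports "HOL-Probability.Probability" "HOL-Library.Landau_Symbols"
begin

text \<open>Graphs in the sense of Friedman: a finite set of vertices, a finite set of
directed edges (darts), tail and head maps, and a fixed-point-free involution
reversing darts.  An undirected edge is an orbit {e, rev e}; a whole-loop is a
dart with equal tail and head; half-loops (rev e = e) are excluded.\<close>

record ('v, 'e) graph =
  verts :: "'v set"
  darts :: "'e set"
  tl    :: "'e \<Rightarrow> 'v"
  hd    :: "'e \<Rightarrow> 'v"
  rev   :: "'e \<Rightarrow> 'e"

definition wf_graph :: "('v, 'e) graph \<Rightarrow> bool" where
  "wf_graph G \<longleftrightarrow> finite (verts G) \<and> finite (darts G) \<and>
     (\<forall>e\<in>darts G. tl G e \<in> verts G \<and> hd G e \<in> verts G \<and> rev G e \<in> darts G \<and>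
        rev G (rev G e) = e \<and> rev G e \<noteq> e \<and> tl G (rev G e) = hd G e)"

text \<open>Order: number of undirected edges minus number of vertices.\<close>
definition graph_ord :: "('v, 'e) graph \<Rightarrow> int" where
  "graph_ord G = int (card (darts G) div 2) - int (card (verts G))"

text \<open>Degree: number of darts with tail v (a whole-loop counts twice).\<close>
definition degree :: "('v, 'e) graph \<Rightarrow> 'v \<Rightarrow> nat" where
  "degree G v = card {e \<in> darts G. tl G e = v}"

definition pruned :: "('v, 'e) graph \<Rightarrow> bool" where
  "pruned G \<longleftrightarrow> (\<forall>v\<in>verts G. degree G v \<ge> 2)"

definition connected_graph :: "('v, 'e) graph \<Rightarrow> bool" where
  "connected_graph G \<longleftrightarrow>
     (\<forall>u\<in>verts G. \<forall>v\<in>verts G. (u, v) \<in> {(tl G e, hd G e) | e. e \<in> darts G}\<^sup>*)"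

text \<open>Graph morphism given by a vertex map and a dart map.\<close>
definition graph_morphism ::
  "('v, 'e) graph \<Rightarrow> ('w, 'f) graph \<Rightarrow> ('v \<Rightarrow> 'w) \<Rightarrow> ('e \<Rightarrow> 'f) \<Rightarrow> bool" where
  "graph_morphism G H fv fe \<longleftrightarrow>
     (\<forall>v\<in>verts G. fv v \<in> verts H) \<and>
     (\<forall>e\<in>darts G. fe e \<in> darts H \<and> tl H (fe e) = fv (tl G e) \<and>
        hd H (fe e) = fv (hd G e) \<and> rev H (fe e) = fe (rev G e))"

text \<open>A B-graph: a graph together with a morphism (pv, pe) to B.\<close>
definition is_B_graph ::
  "('bv, 'be) graph \<Rightarrow> ('v, 'e) graph \<Rightarrow> ('v \<Rightarrow> 'bv) \<Rightarrow> ('e \<Rightarrow> 'be) \<Rightarrow> bool" where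
  "is_B_graph B G pv pe \<longleftrightarrow> wf_graph G \<and> graph_morphism G B pv pe"

definition subgraph :: "('v, 'e) graph \<Rightarrow> ('v, 'e) graph \<Rightarrow> bool" where
  "subgraph H G \<longleftrightarrow> wf_graph H \<and> verts H \<subseteq> verts G \<and> darts H \<subseteq> darts G \<and>
     (\<forall>e\<in>darts H. tl H e = tl G e \<and> hd H e = hd G e \<and> rev H e = rev G e)"

text \<open>Isomorphism of B-graphs (G, pv, pe) and (H, qv, qe).\<close>
definition B_graph_iso ::
  "('v, 'e) graph \<Rightarrow> ('v \<Rightarrow> 'bv) \<Rightarrow> ('e \<Rightarrow> 'be) \<Rightarrow>
   ('w, 'f) graph \<Rightarrow> ('w \<Rightarrow> 'bv) \<Rightarrow> ('f \<Rightarrow> 'be) \<Rightarrow> bool" where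
  "B_graph_iso G pv pe H qv qe \<longleftrightarrow>
     (\<exists>fv fe. bij_betw fv (verts G) (verts H) \<and> bij_betw fe (darts G) (darts H) \<and>
        graph_morphism G H fv fe \<and>
        (\<forall>v\<in>verts G. qv (fv v) = pv v) \<and> (\<forall>e\<in>darts G. qe (fe e) = pe e))"

text \<open>I_Psi(G): 1 if G has a subgraph isomorphic as a B-graph to an element of Psi.\<close>
definition has_Psi_copy ::
  "(('v, 'e) graph \<times> ('v \<Rightarrow> 'bv) \<times> ('e \<Rightarrow> 'be)) set \<Rightarrow>
   ('w, 'f) graph \<Rightarrow> ('w \<Rightarrow> 'bv) \<Rightarrow> ('f \<Rightarrow> 'be) \<Rightarrow> bool" where
  "has_Psi_copy Psi G qv qe \<longleftrightarrow>
     (\<exists>(\<psi>, pv, pe)\<in>Psi. \<exists>H. subgraph H G \<and> B_graph_iso \<psi> pv pe H qv qe)"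

definition indicator_Psi ::
  "(('v, 'e) graph \<times> ('v \<Rightarrow> 'bv) \<times> ('e \<Rightarrow> 'be)) set \<Rightarrow>
   ('w, 'f) graph \<Rightarrow> ('w \<Rightarrow> 'bv) \<Rightarrow> ('f \<Rightarrow> 'be) \<Rightarrow> real" where
  "indicator_Psi Psi G qv qe = (if has_Psi_copy Psi G qv qe then 1 else 0)"

text \<open>Permutation data for an n-cover of B: one permutation of [n] = {..<n} per dart,
with sigma (rev e) = inverse of sigma e (normalised to id off the darts of B).
The uniform distribution on this finite set is the same as choosing independent
uniform permutations, one per undirected edge.\<close>
definition cover_perms :: "('bv, 'be) graph \<Rightarrow> nat \<Rightarrow> ('be \<Rightarrow> nat \<Rightarrow> nat) set" where
  "cover_perms B n = {\<sigma>. (\<forall>e\<in>darts B. \<sigma> e permutes {..<n} \<and> \<sigma> (rev B e) = inv (\<sigma> e)) \<and>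
                         (\<forall>e. e \<notin> darts B \<longrightarrow> \<sigma> e = id)}"

text \<open>The cover graph with vertex set V_B x [n]; the dart over e with tail (t e, i)
has head (h e, sigma e i).\<close>
definition cover_graph ::
  "('bv, 'be) graph \<Rightarrow> nat \<Rightarrow> ('be \<Rightarrow> nat \<Rightarrow> nat) \<Rightarrow> ('bv \<times> nat, 'be \<times> nat) graph" where
  "cover_graph B n \<sigma> =
     \<lparr> verts = verts B \<times> {..<n}, darts = darts B \<times> {..<n},
       tl = (\<lambda>(e, i). (tl B e, i)),
       hd = (\<lambda>(e, i). (hd B e, \<sigma> e i)),
       rev = (\<lambda>(e, i). (rev B e, \<sigma> e i)) \<rparr>"

text \<open>E_{G in C_n(B)} [I_Psi(G)], the covering map being the first projection.\<close>
definition expected_Psi ::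
  "('bv, 'be) graph \<Rightarrow> (('v, 'e) graph \<times> ('v \<Rightarrow> 'bv) \<times> ('e \<Rightarrow> 'be)) set \<Rightarrow> nat \<Rightarrow> real" where
  "expected_Psi B Psi n =
     measure_pmf.expectation (pmf_of_set (cover_perms B n))
       (\<lambda>\<sigma>. indicator_Psi Psi (cover_graph B n \<sigma>) fst fst)"

end

theory Submission
  imports Defs "HOL-Computational_Algebra.Polynomial" "HOL-Combinatorics.Permutations"
begin

text \<open>A set of edges of order \<open>k\<close> (edges minus vertices) occurs in a random \<open>n\<close>-cover in about
\<open>n ^ -k\<close> places on average; the exact expectation is a rational function of \<open>n\<close> and therefore has an
expansion in powers of \<open>1/n\<close>. By Moebius inversion the indicator of containing a copy of a member of
\<open>Psi\<close> is a signed sum over contained edge sets that are unions of copies. Because the members of \<open>Psi\<close>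
are connected, pruned and of positive order, adding a copy not already contained raises the order by at
least one. Hence unions of order below \<open>r\<close> consist of boundedly many copies, so there are finitely many
types of them, each with an expansion starting at \<open>1/n\<close> or later, and discarding all unions of order at
least \<open>r\<close> costs \<open>O(n ^ -r)\<close>.\<close>

section \<open>Asymptotic expansions in powers of 1/n\<close>

text \<open>The exponent has a counting origin. With \<open>a v\<close> vertices over
  \<open>v\<close> and \<open>w e\<close> edges over \<open>e\<close>, the vertices can be chosen in
  a product of binomials \<open>n choose a v\<close> ways, and a given placement occurs with
  probability the product of the quotients \<open>fact (n - w e) / fact n\<close>; the powers of n
  combine to minus the order. Working with edge sets instead of sets of copies matters: many
  families of copies can have the same union, and the Moebius transform collects them into a single
  coefficient of size at most 2 to the number of edges. The obstacle is that truncation cannot be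
  controlled cover by cover, since an exceptional cover may contain a number of low-order unions
  that grows with n. The error is therefore bounded by a multiple of the number of high-order unions
  of bounded size, and only the average of that number is estimated. Fixing one dart per undirected
  edge turns the random cover into independent permutations. Prunedness also excludes isolated
  vertices, so a copy is recoverable from its edges alone.\<close>

definition inv_power_expansion :: "(nat \<Rightarrow> real) \<Rightarrow> bool" where
  "inv_power_expansion f \<longleftrightarrow>
     (\<forall>r. \<exists>p :: real poly. (\<lambda>n. f n - poly p (1 / real n)) \<in> O(\<lambda>n. 1 / real n ^ r))"

lemma poly_inverse_bigo_1: "(\<lambda>n. poly p (1 / real n)) \<in> O(\<lambda>_. 1 :: real)"
proof (rule bigoI_tendsto)
  have "(\<lambda>n. poly p (1 / real n)) \<longlonglongrightarrow> poly p 0"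
    by (intro tendsto_intros lim_1_over_n)
  then show "(\<lambda>n. poly p (1 / real n) / 1) \<longlonglongrightarrow> poly p 0"
    by simp
qed simp

lemma inv_power_expansion_bigo_1:
  assumes "inv_power_expansion f"
  shows "f \<in> O(\<lambda>_. 1 :: real)"
proof -
  obtain p where "(\<lambda>n. f n - poly p (1 / real n)) \<in> O(\<lambda>n. 1 / real n ^ 0)"
    using assms unfolding inv_power_expansion_def by blast
  from sum_in_bigo(1)[OF this[simplified] poly_inverse_bigo_1[of p]] show ?thesis
    by simp
qed

lemma inv_power_expansion_const: "inv_power_expansion (\<lambda>_. c)"
  unfolding inv_power_expansion_def by (intro allI exI[of _ "[:c:]"]) simp

lemma inv_power_expansion_inverse_power: "inv_power_expansion (\<lambda>n. 1 / real n ^ k)"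
  unfolding inv_power_expansion_def
  by (intro allI exI[of _ "monom 1 k"]) (simp add: poly_monom power_one_over)

lemma inv_power_expansion_add:
  assumes "inv_power_expansion f" "inv_power_expansion g"
  shows "inv_power_expansion (\<lambda>n. f n + g n)"
  unfolding inv_power_expansion_def
proof
  fix r
  obtain p q where p: "(\<lambda>n. f n - poly p (1 / real n)) \<in> O(\<lambda>n. 1 / real n ^ r)"
    and q: "(\<lambda>n. g n - poly q (1 / real n)) \<in> O(\<lambda>n. 1 / real n ^ r)"
    using assms unfolding inv_power_expansion_def by blast
  from sum_in_bigo(1)[OF p q]
  have "(\<lambda>n. f n + g n - poly (p + q) (1 / real n)) \<in> O(\<lambda>n. 1 / real n ^ r)"
    by (simp add: algebra_simps)
  then show "\<exists>p. (\<lambda>n. f n + g n - poly p (1 / real n)) \<in> O(\<lambda>n. 1 / real n ^ r)" by blast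
qed

lemma inv_power_expansion_mult:
  assumes "inv_power_expansion f" "inv_power_expansion g"
  shows "inv_power_expansion (\<lambda>n. f n * g n)"
  unfolding inv_power_expansion_def
proof
  fix r
  obtain p q where p: "(\<lambda>n. f n - poly p (1 / real n)) \<in> O(\<lambda>n. 1 / real n ^ r)"
    and q: "(\<lambda>n. g n - poly q (1 / real n)) \<in> O(\<lambda>n. 1 / real n ^ r)"
    using assms unfolding inv_power_expansion_def by blast
  have "(\<lambda>n. f n * (g n - poly q (1 / real n))) \<in> O(\<lambda>n. 1 * (1 / real n ^ r))"
    by (rule landau_o.big.mult[OF inv_power_expansion_bigo_1[OF assms(1)] q])
  moreover have "(\<lambda>n. (f n - poly p (1 / real n)) * poly q (1 / real n)) \<in> O(\<lambda>n. (1 / real n ^ r) * 1)"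
    by (rule landau_o.big.mult[OF p poly_inverse_bigo_1])
  ultimately have "(\<lambda>n. f n * (g n - poly q (1 / real n)) + (f n - poly p (1 / real n)) * poly q (1 / real n))
      \<in> O(\<lambda>n. 1 / real n ^ r)"
    using sum_in_bigo(1)[of _ _ "\<lambda>n. 1 / real n ^ r"] by simp
  then have "(\<lambda>n. f n * g n - poly (p * q) (1 / real n)) \<in> O(\<lambda>n. 1 / real n ^ r)"
    by (simp add: algebra_simps)
  then show "\<exists>p. (\<lambda>n. f n * g n - poly p (1 / real n)) \<in> O(\<lambda>n. 1 / real n ^ r)" by blast
qed

lemma inv_power_expansion_prod:
  assumes "\<And>x. x \<in> A \<Longrightarrow> inv_power_expansion (f x)"
  shows "inv_power_expansion (\<lambda>n. \<Prod>x\<in>A. f x n)"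
  using assms
  by (induction A rule: infinite_finite_induct)
     (auto intro: inv_power_expansion_const inv_power_expansion_mult)

lemma inv_power_expansion_one_minus: "inv_power_expansion (\<lambda>n. 1 - c / real n)"
  using inv_power_expansion_add[OF inv_power_expansion_const[of 1]
      inv_power_expansion_mult[OF inv_power_expansion_const[of "-c"] inv_power_expansion_inverse_power[of 1]]]
  by simp

text \<open>A truncated geometric series in i/n serves as the polynomial.\<close>

lemma inv_power_expansion_inverse_one_minus:
  "inv_power_expansion (\<lambda>n. 1 / (1 - real i / real n))"
  unfolding inv_power_expansion_def
proof
  fix r
  define p where "p = (\<Sum>k<r. monom (real i ^ k) k)"
  \<comment> \<open>This makes x = i/n less than 1/2, so the tail x^r / (1 - x) is at most 2
    x^r.\<close>
  have "eventually (\<lambda>n. n > 2 * i) sequentially" by (rule eventually_gt_at_top)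
  then have "eventually (\<lambda>n. norm (1 / (1 - real i / real n) - poly p (1 / real n))
      \<le> 2 * real i ^ r * norm (1 / real n ^ r)) sequentially"
  proof eventually_elim
    case (elim n)
    define x where "x = real i / real n"
    have x: "0 \<le> x" "x < 1/2" using elim by (auto simp: x_def field_simps)
    have "poly p (1 / real n) = (\<Sum>k<r. x ^ k)"
      by (simp add: p_def poly_sum poly_monom x_def power_divide)
    also have "\<dots> = (1 - x ^ r) / (1 - x)"
      using x by (subst sum_gp_strict) auto
    finally have "1 / (1 - x) - poly p (1 / real n) = x ^ r / (1 - x)"
      by (simp add: diff_divide_distrib)
    also have "norm \<dots> \<le> 2 * x ^ r"
      using x mult_left_mono[of 1 "2 - 2 * x" "x ^ r"] by (simp add: field_simps)
    finally show ?case by (simp add: x_def power_divide)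
  qed
  then have "(\<lambda>n. 1 / (1 - real i / real n) - poly p (1 / real n)) \<in> O(\<lambda>n. 1 / real n ^ r)"
    by (rule bigoI)
  then show "\<exists>p. (\<lambda>n. 1 / (1 - real i / real n) - poly p (1 / real n)) \<in> O(\<lambda>n. 1 / real n ^ r)"
    by blast
qed

lemma inverse_power_bigo: "r \<le> k \<Longrightarrow> (\<lambda>n. c / real n ^ k) \<in> O(\<lambda>n. 1 / real n ^ r)"
proof (rule bigoI[where c = "\<bar>c\<bar>"], rule eventually_mono[OF eventually_gt_at_top[of 0]])
  fix n :: nat assume "r \<le> k" "n > 0"
  then have "real n ^ r \<le> real n ^ k" by (intro power_increasing) auto
  then show "norm (c / real n ^ k) \<le> \<bar>c\<bar> * norm (1 / real n ^ r)"
    using \<open>n > 0\<close> by (auto intro!: divide_left_mono)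
qed

lemma poly_inverse_truncate:
  "(\<lambda>n. poly p (1 / real n) - (\<Sum>k<r. coeff p k / real n ^ k)) \<in> O(\<lambda>n. 1 / real n ^ r)"
proof -
  define N where "N = max r (Suc (Polynomial.degree p))"
  have "poly p (1 / real n) - (\<Sum>k<r. coeff p k / real n ^ k) = (\<Sum>k\<in>{r..<N}. coeff p k / real n ^ k)" for n
  proof -
    have "poly p (1 / real n) = (\<Sum>k<N. coeff p k / real n ^ k)"
      unfolding poly_altdef
      by (rule sum.mono_neutral_cong_left) (auto simp: N_def coeff_eq_0 power_divide not_le)
    also have "\<dots> = (\<Sum>k<r. coeff p k / real n ^ k) + (\<Sum>k\<in>{r..<N}. coeff p k / real n ^ k)"
      by (subst sum.union_disjoint[symmetric]) (auto simp: N_def intro!: sum.cong)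
    finally show ?thesis by simp
  qed
  then show ?thesis
    by (auto intro!: big_sum_in_bigo inverse_power_bigo)
qed

section \<open>Permutations extending a partial injection\<close>

text \<open>Injectivity gives the complements of \<open>A\<close> and of its image in
  \<open>S\<close> the same size; any bijection between them completes \<open>f\<close>.\<close>

lemma permutes_extend:
  assumes "finite S" "A \<subseteq> S" "inj_on f A" "f ` A \<subseteq> S"
  obtains p where "p permutes S" "\<And>x. x \<in> A \<Longrightarrow> p x = f x"
proof -
  have "card (S - A) = card (S - f ` A)"
    using assms by (simp add: card_Diff_subset card_image finite_subset)
  then obtain g where g: "bij_betw g (S - A) (S - f ` A)"
    using assms(1) finite_same_card_bij[of "S - A" "S - f ` A"] by auto
  define p where "p x = (if x \<in> A then f x else if x \<in> S then g x else x)" for x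
  have "bij_betw p A (f ` A)"
    using assms(3) by (subst bij_betw_cong[of _ _ f]) (auto simp: p_def bij_betw_def)
  moreover have "bij_betw p (S - A) (S - f ` A)"
    using g by (subst bij_betw_cong[of _ _ g]) (auto simp: p_def)
  ultimately have "bij_betw p (A \<union> (S - A)) (f ` A \<union> (S - f ` A))"
    by (rule bij_betw_combine) auto
  then have "bij_betw p S S"
    using assms by (simp add: Un_absorb1)
  then have "p permutes S"
    by (rule bij_imp_permutes) (use assms(2) in \<open>auto simp: p_def\<close>)
  then show ?thesis by (rule that) (simp add: p_def)
qed

lemma card_permutes_fixing:
  assumes "finite S" "A \<subseteq> S"
  shows "card {p. p permutes S \<and> (\<forall>x\<in>A. p x = x)} = fact (card S - card A)"
proof -
  have "{p. p permutes S \<and> (\<forall>x\<in>A. p x = x)} = {p. p permutes (S - A)}"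
    by (auto intro: permutes_superset permutes_subset simp: permutes_not_in)
  then show ?thesis
    using assms by (simp add: card_permutations card_Diff_subset finite_subset)
qed

text \<open>Composition with one fixed extension \<open>q\<close> of the partial injection
  \<open>w\<close> identifies the extensions of \<open>w\<close> with the permutations that fix its
  domain pointwise.\<close>

lemma card_permutes_extending:
  assumes "finite S" "w \<subseteq> S \<times> S" "inj_on fst w" "inj_on snd w"
  shows "card {p. p permutes S \<and> (\<forall>(i, j)\<in>w. p i = j)} = fact (card S - card w)"
proof -
  define f where "f = (\<lambda>i. snd (inv_into w fst i))"
  have f: "f i = j" if "(i, j) \<in> w" for i j
    using inv_into_f_f[OF assms(3) that] by (simp add: f_def)
  have "inj_on f (fst ` w)"
    using assms(4) f by (force simp: inj_on_def)
  moreover have "f ` fst ` w \<subseteq> S" "fst ` w \<subseteq> S"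
    using assms(2) f by auto
  ultimately obtain q where q: "q permutes S" "\<And>x. x \<in> fst ` w \<Longrightarrow> q x = f x"
    using permutes_extend[OF assms(1), of "fst ` w" f] by blast
  have ext: "(\<forall>(i, j)\<in>w. p i = j) \<longleftrightarrow> (\<forall>x\<in>fst ` w. p x = q x)" for p
    using q f by force
  have "bij_betw ((\<circ>) q) {p. p permutes S \<and> (\<forall>x\<in>fst ` w. p x = x)}
          {p. p permutes S \<and> (\<forall>x\<in>fst ` w. p x = q x)}"
  proof (rule bij_betw_byWitness[where f' = "(\<circ>) (inv q)"])
    show "\<forall>p\<in>{p. p permutes S \<and> (\<forall>x\<in>fst ` w. p x = x)}. inv q \<circ> (q \<circ> p) = p"
      using q(1) by (auto simp: fun_eq_iff permutes_inverses)
    show "\<forall>p\<in>{p. p permutes S \<and> (\<forall>x\<in>fst ` w. p x = q x)}. q \<circ> (inv q \<circ> p) = p"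
      using q(1) by (auto simp: fun_eq_iff permutes_inverses)
    show "(\<circ>) q ` {p. p permutes S \<and> (\<forall>x\<in>fst ` w. p x = x)}
        \<subseteq> {p. p permutes S \<and> (\<forall>x\<in>fst ` w. p x = q x)}"
      using q(1) by (auto intro: permutes_compose)
    show "(\<circ>) (inv q) ` {p. p permutes S \<and> (\<forall>x\<in>fst ` w. p x = q x)}
        \<subseteq> {p. p permutes S \<and> (\<forall>x\<in>fst ` w. p x = x)}"
      using q(1) by (auto intro: permutes_compose permutes_inv simp: permutes_inverses)
  qed
  then have "card {p. p permutes S \<and> (\<forall>(i, j)\<in>w. p i = j)}
      = card {p. p permutes S \<and> (\<forall>x\<in>fst ` w. p x = x)}"
    unfolding ext by (simp add: bij_betw_same_card)
  also have "\<dots> = fact (card S - card w)"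
    using \<open>fst ` w \<subseteq> S\<close> assms by (subst card_permutes_fixing) (auto simp: card_image)
  finally show ?thesis .
qed

text \<open>Read contrapositively: pairs that clash in one coordinate lie on the graph of no
  permutation, which accounts for the value 0 in \<open>ext_prob\<close>.\<close>

lemma permutes_graph_inj:
  assumes "p permutes S" "\<forall>(i, j)\<in>w. p i = j"
  shows "inj_on fst w" "inj_on snd w"
proof -
  have w: "p (fst x) = snd x" if "x \<in> w" for x
    using assms(2) that by auto
  then show "inj_on fst w"
    by (metis inj_onI prod_eqI)
  show "inj_on snd w"
    using w permutes_inj[OF assms(1)] by (metis inj_onI injD prod_eqI)
qed

section \<open>Expansions with prescribed leading order\<close>

text \<open>Equality is asked only for large n, because the product formula for factorial quotients
  needs n to be at least the number of removed factors. As \<open>g\<close> may tend to 0,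
  \<open>k\<close> is a lower bound for the leading order.\<close>

definition inv_power_expansion_from :: "nat \<Rightarrow> (nat \<Rightarrow> real) \<Rightarrow> bool" where
  "inv_power_expansion_from k f \<longleftrightarrow>
     (\<exists>g. inv_power_expansion g \<and> (\<forall>\<^sub>F n in sequentially. f n = g n / real n ^ k))"

lemma inv_power_expansion_from_bigo:
  assumes "inv_power_expansion_from k f"
  shows "f \<in> O(\<lambda>n. 1 / real n ^ k)"
proof -
  obtain g where g: "inv_power_expansion g" "\<forall>\<^sub>F n in sequentially. f n = g n / real n ^ k"
    using assms unfolding inv_power_expansion_from_def by blast
  have "(\<lambda>n. g n * (1 / real n ^ k)) \<in> O(\<lambda>n. 1 * (1 / real n ^ k))"
    by (intro landau_o.big.mult inv_power_expansion_bigo_1 g) simp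
  then show ?thesis
    using landau_o.big.in_cong[OF g(2)] by simp
qed

lemma inv_power_expansion_from_add:
  assumes "inv_power_expansion_from k f" "inv_power_expansion_from k g"
  shows "inv_power_expansion_from k (\<lambda>n. f n + g n)"
proof -
  obtain f' g' where "inv_power_expansion f'" "\<forall>\<^sub>F n in sequentially. f n = f' n / real n ^ k"
    "inv_power_expansion g'" "\<forall>\<^sub>F n in sequentially. g n = g' n / real n ^ k"
    using assms unfolding inv_power_expansion_from_def by blast
  then have "inv_power_expansion (\<lambda>n. f' n + g' n)"
    "\<forall>\<^sub>F n in sequentially. f n + g n = (f' n + g' n) / real n ^ k"
    by (auto intro: inv_power_expansion_add elim: eventually_elim2 simp: add_divide_distrib)
  then show ?thesis unfolding inv_power_expansion_from_def by blast
qed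

lemma inv_power_expansion_from_zero: "inv_power_expansion_from k (\<lambda>_. 0)"
  unfolding inv_power_expansion_from_def
  by (rule exI[of _ "\<lambda>_. 0"]) (simp add: inv_power_expansion_const)

lemma inv_power_expansion_from_sum:
  assumes "\<And>x. x \<in> A \<Longrightarrow> inv_power_expansion_from k (f x)"
  shows "inv_power_expansion_from k (\<lambda>n. \<Sum>x\<in>A. f x n)"
  using assms
  by (induction A rule: infinite_finite_induct)
     (auto intro: inv_power_expansion_from_zero inv_power_expansion_from_add)

lemma inv_power_expansion_from_cmult:
  assumes "inv_power_expansion_from k f"
  shows "inv_power_expansion_from k (\<lambda>n. c * f n)"
proof -
  obtain f' where "inv_power_expansion f'" "\<forall>\<^sub>F n in sequentially. f n = f' n / real n ^ k"
    using assms unfolding inv_power_expansion_from_def by blast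
  then have "inv_power_expansion (\<lambda>n. c * f' n)"
    "\<forall>\<^sub>F n in sequentially. c * f n = (c * f' n) / real n ^ k"
    by (auto intro: inv_power_expansion_mult inv_power_expansion_const elim: eventually_mono)
  then show ?thesis unfolding inv_power_expansion_from_def by blast
qed

lemma inv_power_expansion_from_cong:
  assumes "\<forall>\<^sub>F n in sequentially. f n = g n" "inv_power_expansion_from k g"
  shows "inv_power_expansion_from k f"
proof -
  obtain g' where g': "inv_power_expansion g'" "\<forall>\<^sub>F n in sequentially. g n = g' n / real n ^ k"
    using assms unfolding inv_power_expansion_from_def by blast
  have "\<forall>\<^sub>F n in sequentially. f n = g' n / real n ^ k"
    using assms(1) g'(2) by eventually_elim simp
  then show ?thesis using g'(1) unfolding inv_power_expansion_from_def by blast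
qed

text \<open>The falling factorial with n pulled out of each factor. For a > n both sides vanish, on
  the right through the factor i = n.\<close>

lemma choose_eq_power_times:
  assumes "n > 0"
  shows "real (n choose a) = real n ^ a * ((\<Prod>i<a. 1 - real i / real n) / fact a)"
proof -
  have "real (n choose a) = (\<Prod>i<a. real n - real i) / fact a"
    by (simp add: binomial_gbinomial gbinomial_prod_rev atLeast0LessThan)
  also have "(\<Prod>i<a. real n - real i) = (\<Prod>i<a. real n * (1 - real i / real n))"
    using assms by (intro prod.cong) (auto simp: field_simps)
  finally show ?thesis by (simp add: prod.distrib)
qed

lemma fact_quotient_eq_power_times:
  assumes "n > 0" "w \<le> n"
  shows "fact (n - w) / fact n = (\<Prod>i<w. 1 / (1 - real i / real n)) / real n ^ w"
  using assms(2)
proof (induction w)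
  case (Suc w)
  have "fact (n - w) = real (n - w) * fact (n - Suc w)"
    using Suc.prems by (metis Suc_diff_Suc Suc_le_lessD fact_Suc of_nat_fact of_nat_mult)
  then have "(fact (n - Suc w) :: real) = fact (n - w) / (real n - real w)"
    using Suc.prems by (simp add: of_nat_diff)
  then have "fact (n - Suc w) / fact n = (fact (n - w) / fact n) / (real n - real w)"
    by simp
  also have "\<dots> = ((\<Prod>i<w. 1 / (1 - real i / real n)) / real n ^ w) / (real n - real w)"
    using Suc by simp
  also have "\<dots> = (\<Prod>i<Suc w. 1 / (1 - real i / real n)) / real n ^ Suc w"
    using Suc.prems assms(1) by (simp add: field_simps)
  finally show ?case .
qed simp

text \<open>Pulling out all powers of n leaves factors 1 - i/n and their inverses, which have
  expansions; the surplus \<open>m\<close> of the exponent over \<open>k\<close> is absorbed into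
  \<open>g\<close>.\<close>

lemma inv_power_expansion_from_binomial_quotient:
  assumes "finite V" "finite E" and ord: "(\<Sum>v\<in>V. a v) + k \<le> (\<Sum>e\<in>E. w e)"
  shows "inv_power_expansion_from k
           (\<lambda>n. (\<Prod>v\<in>V. real (n choose a v)) * (\<Prod>e\<in>E. fact (n - w e) / fact n))"
proof -
  define m where "m = (\<Sum>e\<in>E. w e) - ((\<Sum>v\<in>V. a v) + k)"
  define g where "g n = ((\<Prod>v\<in>V. (\<Prod>i<a v. 1 - real i / real n) * (1 / fact (a v))) *
      (\<Prod>e\<in>E. \<Prod>i<w e. 1 / (1 - real i / real n))) * (1 / real n ^ m)" for n
  have "inv_power_expansion g"
    unfolding g_def
    by (intro inv_power_expansion_mult inv_power_expansion_prod inv_power_expansion_const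
          inv_power_expansion_one_minus inv_power_expansion_inverse_one_minus
          inv_power_expansion_inverse_power)
  moreover have "\<forall>\<^sub>F n in sequentially. (\<Prod>v\<in>V. real (n choose a v)) * (\<Prod>e\<in>E. fact (n - w e) / fact n)
      = g n / real n ^ k"
    \<comment> \<open>Exceeding the sum bounds every single \<open>w e\<close> by n, and strictness
      makes n positive.\<close>
    using eventually_gt_at_top[of "\<Sum>e\<in>E. w e"]
  proof eventually_elim
    case (elim n)
    have n: "n > 0" using elim by simp
    have w: "w e \<le> n" if "e \<in> E" for e
      using member_le_sum[OF that, of w] assms elim by simp
    have "(\<Prod>v\<in>V. real (n choose a v)) * (\<Prod>e\<in>E. fact (n - w e) / fact n)
       = (\<Prod>v\<in>V. real n ^ a v * ((\<Prod>i<a v. 1 - real i / real n) / fact (a v))) *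
         (\<Prod>e\<in>E. (\<Prod>i<w e. 1 / (1 - real i / real n)) / real n ^ w e)"
      using n w by (intro arg_cong2[where f = "(*)"] prod.cong refl choose_eq_power_times
          fact_quotient_eq_power_times)
    also have "\<dots> = (real n ^ (\<Sum>v\<in>V. a v) / real n ^ (\<Sum>e\<in>E. w e)) *
      ((\<Prod>v\<in>V. (\<Prod>i<a v. 1 - real i / real n) * (1 / fact (a v))) *
      (\<Prod>e\<in>E. \<Prod>i<w e. 1 / (1 - real i / real n)))"
      by (simp add: prod.distrib prod_dividef power_sum)
    also have "real n ^ (\<Sum>v\<in>V. a v) / real n ^ (\<Sum>e\<in>E. w e) = 1 / real n ^ m / real n ^ k"
    proof -
      have "(\<Sum>e\<in>E. w e) = m + k + (\<Sum>v\<in>V. a v)" using ord by (simp add: m_def)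
      then show ?thesis using n by (simp add: power_add)
    qed
    finally show ?case by (simp add: g_def)
  qed
  ultimately show ?thesis unfolding inv_power_expansion_from_def by blast
qed

lemma inj_on_map_prod_image_iff:
  assumes "inj f" "inj g"
  shows "inj_on fst (map_prod f g ` X) \<longleftrightarrow> inj_on fst X"
    and "inj_on snd (map_prod f g ` X) \<longleftrightarrow> inj_on snd X"
proof -
  have m: "inj_on (map_prod f g) X"
    by (rule inj_on_subset[OF prod.inj_map[OF assms]]) simp
  have "inj_on (f \<circ> fst) X \<longleftrightarrow> inj_on fst X" "inj_on (g \<circ> snd) X \<longleftrightarrow> inj_on snd X"
    by (simp_all add: inj_on_def[of _ X] inj_eq[OF assms(1)] inj_eq[OF assms(2)])
  then show "inj_on fst (map_prod f g ` X) \<longleftrightarrow> inj_on fst X"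
    and "inj_on snd (map_prod f g ` X) \<longleftrightarrow> inj_on snd X"
    by (simp_all add: comp_inj_on_iff[OF m])
qed

section \<open>Edge sets in a fibred vertex set\<close>

text \<open>A subgraph without isolated vertices of a cover of \<open>(V, E)\<close> is encoded by its edges: the triple
\<open>(e, i, j)\<close> is the edge over \<open>e\<close> from \<open>(t e, i)\<close> to \<open>(h e, j)\<close>. It lies in the cover given by
\<open>\<sigma>\<close> iff \<open>\<sigma> e i = j\<close>, and \<open>ext_prob n W\<close> is the probability that all edges in \<open>W\<close> do.\<close>

locale fibred_edges =
  fixes V :: "'v set" and E :: "'e set" and t h :: "'e \<Rightarrow> 'v"
  assumes finite_V: "finite V" and finite_E: "finite E"
    and t_in: "e \<in> E \<Longrightarrow> t e \<in> V" and h_in: "e \<in> E \<Longrightarrow> h e \<in> V"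
begin

definition triples :: "nat \<Rightarrow> ('e \<times> nat \<times> nat) set" where
  "triples n = E \<times> {..<n} \<times> {..<n}"

definition supp :: "('e \<times> nat \<times> nat) set \<Rightarrow> ('v \<times> nat) set" where
  "supp W = (\<lambda>(e, i, j). (t e, i)) ` W \<union> (\<lambda>(e, i, j). (h e, j)) ` W"

text \<open>An edge set has no isolated vertices, so this is the order of the subgraph it encodes.
  It is an integer because forests have negative order.\<close>

definition ord :: "('e \<times> nat \<times> nat) set \<Rightarrow> int" where
  "ord W = int (card W) - int (card (supp W))"

definition fibre :: "('e \<times> nat \<times> nat) set \<Rightarrow> 'v \<Rightarrow> nat set" where
  "fibre W v = {i. (v, i) \<in> supp W}"

definition over :: "('e \<times> nat \<times> nat) set \<Rightarrow> 'e \<Rightarrow> (nat \<times> nat) set" where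
  "over W e = {(i, j). (e, i, j) \<in> W}"

definition relabel :: "('v \<Rightarrow> nat \<Rightarrow> nat) \<Rightarrow> 'e \<times> nat \<times> nat \<Rightarrow> 'e \<times> nat \<times> nat" where
  "relabel \<pi> = (\<lambda>(e, i, j). (e, \<pi> (t e) i, \<pi> (h e) j))"

text \<open>For edge sets inside \<open>triples n\<close> this is the only obstruction to occurring
  in some cover.\<close>

definition partial_inj :: "('e \<times> nat \<times> nat) set \<Rightarrow> bool" where
  "partial_inj W \<longleftrightarrow> (\<forall>e\<in>E. inj_on fst (over W e) \<and> inj_on snd (over W e))"

text \<open>Independence over the edges gives the product. A formula is used instead of a
  probability so that invariance holds under relabellings that move indices across n; the two agree
  for subsets of \<open>triples n\<close>.\<close>

definition ext_prob :: "nat \<Rightarrow> ('e \<times> nat \<times> nat) set \<Rightarrow> real" where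
  "ext_prob n W = (if partial_inj W then \<Prod>e\<in>E. fact (n - card (over W e)) / fact n else 0)"

text \<open>Bijections of all natural numbers, separately in each fibre, keep the notion independent
  of n.\<close>

definition relabel_invariant :: "(('e \<times> nat \<times> nat) set \<Rightarrow> 'b) \<Rightarrow> bool" where
  "relabel_invariant f \<longleftrightarrow> (\<forall>\<pi> W. (\<forall>v. bij (\<pi> v)) \<longrightarrow> f (relabel \<pi> ` W) = f W)"

lemma supp_memI:
  assumes "(e, i, j) \<in> W"
  shows "(t e, i) \<in> supp W" "(h e, j) \<in> supp W"
  using assms by (force simp: supp_def)+

section \<open>Invariance under fibrewise relabelling\<close>

lemma inj_relabel: "(\<And>v. bij (\<pi> v)) \<Longrightarrow> inj (relabel \<pi>)"
  by (rule injI) (auto simp: relabel_def dest: bij_is_inj[THEN injD])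

lemma relabel_inverse:
  assumes "\<And>v. bij (\<pi> v)"
  shows "relabel (\<lambda>v. inv (\<pi> v)) (relabel \<pi> x) = x" "relabel \<pi> (relabel (\<lambda>v. inv (\<pi> v)) x) = x"
proof -
  have "inv (\<pi> v) (\<pi> v i) = i" "\<pi> v (inv (\<pi> v) i) = i" for v i
    using assms[of v] by (simp_all add: bij_def surj_f_inv_f)
  then show "relabel (\<lambda>v. inv (\<pi> v)) (relabel \<pi> x) = x" "relabel \<pi> (relabel (\<lambda>v. inv (\<pi> v)) x) = x"
    by (auto simp: relabel_def split: prod.splits)
qed

lemma supp_relabel: "supp (relabel \<pi> ` W) = (\<lambda>(v, i). (v, \<pi> v i)) ` supp W"
  by (simp add: supp_def relabel_def image_Un image_image case_prod_beta)

lemma fibre_relabel: "fibre (relabel \<pi> ` W) v = \<pi> v ` fibre W v"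
  by (auto simp: fibre_def supp_relabel)

lemma over_relabel: "over (relabel \<pi> ` W) e = map_prod (\<pi> (t e)) (\<pi> (h e)) ` over W e"
  by (auto simp: over_def relabel_def image_iff Bex_def)

lemma relabel_invariant_card: "relabel_invariant card"
  unfolding relabel_invariant_def
  by (intro allI impI card_image inj_on_subset[OF inj_relabel]) auto

lemma relabel_invariant_ord: "relabel_invariant ord"
  unfolding relabel_invariant_def
proof (intro allI impI)
  fix \<pi> :: "'v \<Rightarrow> nat \<Rightarrow> nat" and W :: "('e \<times> nat \<times> nat) set"
  assume \<pi>: "\<forall>v. bij (\<pi> v)"
  then have "inj_on (\<lambda>(v, i). (v, \<pi> v i)) (supp W)"
    by (auto simp: inj_on_def bij_def)
  then show "ord (relabel \<pi> ` W) = ord W"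
    using relabel_invariant_card \<pi> by (simp add: ord_def relabel_invariant_def supp_relabel card_image)
qed

lemma relabel_invariant_ext_prob: "relabel_invariant (ext_prob n)"
  unfolding relabel_invariant_def
proof (intro allI impI)
  fix \<pi> :: "'v \<Rightarrow> nat \<Rightarrow> nat" and W :: "('e \<times> nat \<times> nat) set"
  assume "\<forall>v. bij (\<pi> v)"
  then have \<pi>: "inj (\<pi> v)" for v by (simp add: bij_def)
  have "inj (map_prod (\<pi> (t e)) (\<pi> (h e)))" for e
    using \<pi> by (simp add: prod.inj_map)
  then have "card (over (relabel \<pi> ` W) e) = card (over W e)" for e
    unfolding over_relabel by (metis card_image inj_on_subset subset_UNIV)
  moreover have "inj_on fst (over (relabel \<pi> ` W) e) \<longleftrightarrow> inj_on fst (over W e)"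
    "inj_on snd (over (relabel \<pi> ` W) e) \<longleftrightarrow> inj_on snd (over W e)" for e
    using \<pi> by (simp_all add: over_relabel inj_on_map_prod_image_iff)
  ultimately show "ext_prob n (relabel \<pi> ` W) = ext_prob n W"
    by (simp add: ext_prob_def partial_inj_def)
qed

lemma fibre_outside: "W \<subseteq> E \<times> UNIV \<Longrightarrow> v \<notin> V \<Longrightarrow> fibre W v = {}"
  by (auto simp: fibre_def supp_def dest: t_in h_in)

lemma finite_supp: "finite W \<Longrightarrow> finite (supp W)"
  by (simp add: supp_def)

lemma finite_fibre: "finite W \<Longrightarrow> finite (fibre W v)"
  by (rule finite_subset[of _ "snd ` supp W"]) (force simp: fibre_def finite_supp)+

lemma finite_over: "finite W \<Longrightarrow> finite (over W e)"
proof -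
  assume "finite W"
  moreover have "over W e \<subseteq> snd ` W" by (force simp: over_def)
  ultimately show ?thesis by (meson finite_imageI finite_subset)
qed

lemma card_supp:
  assumes "finite W" "W \<subseteq> E \<times> UNIV"
  shows "card (supp W) = (\<Sum>v\<in>V. card (fibre W v))"
proof -
  have "supp W = Sigma V (fibre W)"
    using fibre_outside[OF assms(2)] by (auto simp: fibre_def)
  then show ?thesis by (simp add: finite_V finite_fibre assms(1))
qed

lemma card_over:
  assumes "finite W" "W \<subseteq> E \<times> UNIV"
  shows "card W = (\<Sum>e\<in>E. card (over W e))"
proof -
  have "W = Sigma E (over W)"
    using assms(2) by (auto simp: over_def)
  then have "card W = card (Sigma E (over W))" by simp
  also have "\<dots> = (\<Sum>e\<in>E. card (over W e))"
    by (rule card_SigmaI) (simp_all add: finite_E finite_over assms(1))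
  finally show ?thesis .
qed

lemma card_supp_le: "finite W \<Longrightarrow> card (supp W) \<le> 2 * card W"
  unfolding supp_def mult_2 by (intro order.trans[OF card_Un_le] add_mono card_image_le)

lemma card_fibre_le:
  assumes "finite W"
  shows "card (fibre W v) \<le> 2 * card W"
proof -
  have "card (fibre W v) = card (Pair v ` fibre W v)"
    by (simp add: card_image inj_on_def)
  also have "\<dots> \<le> card (supp W)"
    using assms by (intro card_mono finite_supp) (auto simp: fibre_def)
  finally show ?thesis using card_supp_le[OF assms] by simp
qed

section \<open>Counting edge sets by their vertex fibres\<close>

definition configs :: "('v \<Rightarrow> nat set) \<Rightarrow> ('e \<times> nat \<times> nat) set set" where
  "configs A = {W. W \<subseteq> E \<times> UNIV \<and> (\<forall>v\<in>V. fibre W v = A v)}"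

lemma configs_subset_triples:
  assumes "W \<in> configs A" "\<And>v. v \<in> V \<Longrightarrow> A v \<subseteq> {..<n}"
  shows "W \<subseteq> triples n"
proof
  fix x assume x: "x \<in> W"
  obtain e i j where [simp]: "x = (e, i, j)" by (cases x)
  have e: "e \<in> E" using x assms(1) by (auto simp: configs_def)
  have "i \<in> fibre W (t e)" "j \<in> fibre W (h e)"
    using x by (force simp: fibre_def supp_def)+
  then have "i \<in> A (t e)" "j \<in> A (h e)"
    using assms(1) t_in[OF e] h_in[OF e] by (auto simp: configs_def)
  then show "x \<in> triples n"
    using e t_in[OF e] h_in[OF e] assms(2) by (auto simp: triples_def)
qed

lemma finite_triples: "finite (triples n)"
  by (simp add: triples_def finite_E)

lemma fibre_triples_less: "W \<subseteq> triples n \<Longrightarrow> i \<in> fibre W v \<Longrightarrow> i < n"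
  by (auto simp: fibre_def supp_def triples_def)

lemma triples_subset: "triples n \<subseteq> E \<times> UNIV"
  by (auto simp: triples_def)

text \<open>Fibrewise bijections carrying initial segments onto the sets \<open>A v\<close> map one
  collection of configurations bijectively onto the other, and \<open>f\<close> does not
  notice.\<close>

lemma sum_configs_relabel:
  fixes f :: "('e \<times> nat \<times> nat) set \<Rightarrow> real"
  assumes inv: "relabel_invariant f" and A: "\<And>v. v \<in> V \<Longrightarrow> finite (A v)"
  shows "(\<Sum>W\<in>configs A. f W) = (\<Sum>W\<in>configs (\<lambda>v. {..<card (A v)}). f W)"
proof -
  have "\<exists>p. bij p \<and> p ` {..<card (A v)} = A v" if "v \<in> V" for v
  proof -
    \<comment> \<open>The bijection onto \<open>A v\<close> is extended inside a finite segment
      containing \<open>A v\<close>; beyond it the resulting permutation is the identity, hence a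
      bijection of all natural numbers.\<close>
    obtain n where n: "A v \<subseteq> {..<n}" using A[OF \<open>v \<in> V\<close>] finite_nat_iff_bounded by blast
    obtain b where b: "bij_betw b {..<card (A v)} (A v)"
      using ex_bij_betw_nat_finite[OF A[OF \<open>v \<in> V\<close>]] by (auto simp: atLeast0LessThan)
    have "card (A v) \<le> n" using card_mono[OF _ n] by simp
    then obtain p where "p permutes {..<n}" "\<And>x. x \<in> {..<card (A v)} \<Longrightarrow> p x = b x"
      using permutes_extend[of "{..<n}" "{..<card (A v)}" b] b n
      by (auto simp: bij_betw_def)
    then show ?thesis
      using b permutes_bij[of p] by (intro exI[of _ p]) (auto simp: bij_betw_def)
  qed
  then obtain q where q: "\<And>v. v \<in> V \<Longrightarrow> bij (q v) \<and> q v ` {..<card (A v)} = A v"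
    by metis
  define \<pi> where "\<pi> v = (if v \<in> V then q v else id)" for v
  have \<pi>: "bij (\<pi> v)" for v using q by (simp add: \<pi>_def)
  have \<pi>A: "\<pi> v ` {..<card (A v)} = A v" if "v \<in> V" for v using q that by (simp add: \<pi>_def)
  define \<rho> where "\<rho> v = inv (\<pi> v)" for v
  have \<rho>\<pi>: "\<rho> v (\<pi> v i) = i" for v i
    using \<pi>[of v] by (simp add: \<rho>_def bij_def)
  have rel: "relabel \<rho> (relabel \<pi> x) = x" "relabel \<pi> (relabel \<rho> x) = x" for x
    using relabel_inverse[of \<pi>, OF \<pi>] by (simp_all add: \<rho>_def[abs_def])
  have \<rho>A: "\<rho> v ` A v = {..<card (A v)}" if "v \<in> V" for v
    by (subst \<pi>A[OF that, symmetric]) (simp add: image_image \<rho>\<pi>)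
  have "bij_betw (image (relabel \<pi>)) (configs (\<lambda>v. {..<card (A v)})) (configs A)"
  proof (rule bij_betw_byWitness[where f' = "image (relabel \<rho>)"])
    show "(`) (relabel \<pi>) ` configs (\<lambda>v. {..<card (A v)}) \<subseteq> configs A"
      using \<pi>A by (auto simp: configs_def fibre_relabel) (auto simp: relabel_def)
    show "(`) (relabel \<rho>) ` configs A \<subseteq> configs (\<lambda>v. {..<card (A v)})"
      using \<rho>A by (auto simp: configs_def fibre_relabel) (auto simp: relabel_def)
  qed (simp_all add: image_image rel)
  then have "(\<Sum>W\<in>configs A. f W) = (\<Sum>W\<in>configs (\<lambda>v. {..<card (A v)}). f (relabel \<pi> ` W))"
    by (rule sum.reindex_bij_betw[symmetric])
  also have "\<dots> = (\<Sum>W\<in>configs (\<lambda>v. {..<card (A v)}). f W)"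
    using inv \<pi> by (simp add: relabel_invariant_def)
  finally show ?thesis .
qed

text \<open>Every configuration is a relabelling of one whose vertex fibres are initial segments, so only the
choice of the fibres depends on \<open>n\<close>; this avoids isomorphism classes and automorphism counts.\<close>

lemma sum_relabel_invariant:
  fixes f :: "('e \<times> nat \<times> nat) set \<Rightarrow> real"
  assumes "relabel_invariant f"
  shows "(\<Sum>W\<in>Pow (triples n). f W)
       = (\<Sum>a\<in>PiE V (\<lambda>_. {..n}). (\<Prod>v\<in>V. real (n choose a v)) * (\<Sum>W\<in>configs (\<lambda>v. {..<a v}). f W))"
proof -
  define S where "S a = (\<Sum>W\<in>configs (\<lambda>v. {..<a v}). f W)" for a
  let ?\<A> = "PiE V (\<lambda>_. Pow {..<n})"
  let ?a = "\<lambda>A. \<lambda>v\<in>V. card (A v)"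
  \<comment> \<open>Two groupings: edge sets by their fibres, then fibres by their sizes. The
    binomials count the choices of fibres with given sizes.\<close>
  have "(\<Sum>W\<in>Pow (triples n). f W)
      = (\<Sum>A\<in>?\<A>. \<Sum>W\<in>{W \<in> Pow (triples n). restrict (fibre W) V = A}. f W)"
    by (intro sum.group[symmetric])
       (auto simp: finite_triples finite_V dest: fibre_triples_less intro!: finite_PiE)
  also have "\<dots> = (\<Sum>A\<in>?\<A>. S (?a A))"
  proof (rule sum.cong[OF refl])
    fix A assume A: "A \<in> ?\<A>"
    have "{W \<in> Pow (triples n). restrict (fibre W) V = A} = configs A"
    proof (intro set_eqI iffI)
      fix W assume "W \<in> {W \<in> Pow (triples n). restrict (fibre W) V = A}"
      then show "W \<in> configs A" using triples_subset by (auto simp: configs_def)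
    next
      fix W assume W: "W \<in> configs A"
      then have "W \<subseteq> triples n" by (rule configs_subset_triples) (use A in auto)
      moreover have "restrict (fibre W) V = A"
        using W A by (intro extensionalityI[of _ V]) (auto simp: configs_def PiE_def)
      ultimately show "W \<in> {W \<in> Pow (triples n). restrict (fibre W) V = A}" by simp
    qed
    then have "(\<Sum>W\<in>{W \<in> Pow (triples n). restrict (fibre W) V = A}. f W) = (\<Sum>W\<in>configs A. f W)"
      by simp
    also have "\<dots> = (\<Sum>W\<in>configs (\<lambda>v. {..<card (A v)}). f W)"
      using A by (intro sum_configs_relabel assms) (auto intro: finite_subset)
    also have "configs (\<lambda>v. {..<card (A v)}) = configs (\<lambda>v. {..<?a A v})"
      by (simp add: configs_def)
    finally show "(\<Sum>W\<in>{W \<in> Pow (triples n). restrict (fibre W) V = A}. f W) = S (?a A)"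
      unfolding S_def .
  qed
  also have "\<dots> = (\<Sum>a\<in>PiE V (\<lambda>_. {..n}). \<Sum>A\<in>{A \<in> ?\<A>. ?a A = a}. S (?a A))"
  proof (rule sum.group[symmetric])
    show "?a ` ?\<A> \<subseteq> PiE V (\<lambda>_. {..n})"
    proof -
      have "card X \<le> n" if "X \<subseteq> {..<n}" for X
        using card_mono[OF _ that] by simp
      then show ?thesis by (auto simp: PiE_def Pi_def)
    qed
  qed (auto simp: finite_V intro!: finite_PiE)
  also have "\<dots> = (\<Sum>a\<in>PiE V (\<lambda>_. {..n}). (\<Prod>v\<in>V. real (n choose a v)) * S a)"
  proof (rule sum.cong[OF refl])
    fix a assume a: "a \<in> PiE V (\<lambda>_. {..n})"
    have "{A \<in> ?\<A>. ?a A = a} = PiE V (\<lambda>v. {X. X \<subseteq> {..<n} \<and> card X = a v})"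
      using a by (auto simp: PiE_def Pi_def fun_eq_iff extensional_def)
    then have "card {A \<in> ?\<A>. ?a A = a} = (\<Prod>v\<in>V. n choose a v)"
      by (simp add: card_PiE finite_V n_subsets)
    then show "(\<Sum>A\<in>{A \<in> ?\<A>. ?a A = a}. S (?a A)) = (\<Prod>v\<in>V. real (n choose a v)) * S a"
      by simp
  qed
  finally show ?thesis by (simp add: S_def)
qed

lemma finite_configs:
  assumes "\<And>v. v \<in> V \<Longrightarrow> finite (A v)"
  shows "finite (configs A)"
proof -
  obtain n where "(\<Union>v\<in>V. A v) \<subseteq> {..<n}"
    using assms finite_V finite_nat_iff_bounded[of "\<Union>v\<in>V. A v"] by auto
  then have "configs A \<subseteq> Pow (triples n)"
    by (auto dest!: configs_subset_triples[of _ A n])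
  then show ?thesis
    by (rule finite_subset) (simp add: finite_triples)
qed

text \<open>The bound on \<open>card W\<close> leaves finitely many size vectors, independent of n,
  and so finitely many configurations; each contributes a binomial quotient of order at least
  \<open>k\<close>.\<close>

lemma inv_power_expansion_from_sum_ext_prob:
  fixes f :: "('e \<times> nat \<times> nat) set \<Rightarrow> real"
  assumes inv: "relabel_invariant f"
    and supp: "\<And>W. finite W \<Longrightarrow> W \<subseteq> E \<times> UNIV \<Longrightarrow> f W \<noteq> 0 \<Longrightarrow> card W \<le> M \<and> int k \<le> ord W"
  shows "inv_power_expansion_from k (\<lambda>n. \<Sum>W\<in>Pow (triples n). f W * ext_prob n W)"
proof -
  \<comment> \<open>An edge set with at most \<open>M\<close> edges touches at most
    \<open>2 * M\<close> vertices, so larger fibre sizes contribute nothing.\<close>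
  let ?A = "PiE V (\<lambda>_. {..2 * M})"
  let ?s = "\<lambda>a n. (\<Prod>v\<in>V. real (n choose a v)) *
      (\<Sum>W\<in>configs (\<lambda>v. {..<a v}). f W * ext_prob n W)"
  have fin: "finite W" if "W \<in> configs (\<lambda>v. {..<a v})" for W and a :: "'v \<Rightarrow> nat"
  proof -
    have "W \<subseteq> triples (\<Sum>v\<in>V. a v)"
      by (rule configs_subset_triples[OF that]) (use finite_V in \<open>auto intro: order.strict_trans2 member_le_sum\<close>)
    then show ?thesis using finite_triples finite_subset by blast
  qed
  have "inv_power_expansion_from k (\<lambda>n. \<Sum>a\<in>?A. ?s a n)"
  proof (rule inv_power_expansion_from_sum)
    fix a assume a: "a \<in> ?A"
    \<comment> \<open>Whether \<open>W\<close> is a partial injection does not depend on n, so the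
      case distinction moves into the constant coefficient.\<close>
    have "inv_power_expansion_from k (\<lambda>n. \<Sum>W\<in>configs (\<lambda>v. {..<a v}).
        (if partial_inj W then f W else 0) *
        ((\<Prod>v\<in>V. real (n choose a v)) * (\<Prod>e\<in>E. fact (n - card (over W e)) / fact n)))"
    proof (rule inv_power_expansion_from_sum)
      fix W assume W: "W \<in> configs (\<lambda>v. {..<a v})"
      show "inv_power_expansion_from k (\<lambda>n. (if partial_inj W then f W else 0) *
        ((\<Prod>v\<in>V. real (n choose a v)) * (\<Prod>e\<in>E. fact (n - card (over W e)) / fact n)))"
      proof (cases "f W = 0")
        case True
        then show ?thesis by (simp add: inv_power_expansion_from_zero)
      next
        case False
        have WE: "W \<subseteq> E \<times> UNIV" and fib: "\<And>v. v \<in> V \<Longrightarrow> card (fibre W v) = a v"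
          using W by (auto simp: configs_def)
        have "int k \<le> ord W" using supp[OF fin[OF W] WE False] by simp
        then have "card (supp W) + k \<le> card W" by (simp add: ord_def)
        then have "(\<Sum>v\<in>V. a v) + k \<le> (\<Sum>e\<in>E. card (over W e))"
          unfolding card_supp[OF fin[OF W] WE] card_over[OF fin[OF W] WE] using fib by simp
        then show ?thesis
          by (intro inv_power_expansion_from_cmult inv_power_expansion_from_binomial_quotient
              finite_V finite_E)
      qed
    qed
    then show "inv_power_expansion_from k (?s a)"
      by (rule inv_power_expansion_from_cong[rotated])
         (auto simp: sum_distrib_left ext_prob_def intro!: always_eventually sum.cong)
  qed
  moreover have "\<forall>\<^sub>F n in sequentially.
      (\<Sum>W\<in>Pow (triples n). f W * ext_prob n W) = (\<Sum>a\<in>?A. ?s a n)"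
    using eventually_ge_at_top[of "2 * M"]
  proof eventually_elim
    case (elim n)
    have "relabel_invariant (\<lambda>W. f W * ext_prob n W)"
      using inv relabel_invariant_ext_prob[of n] by (simp add: relabel_invariant_def)
    then have "(\<Sum>W\<in>Pow (triples n). f W * ext_prob n W) = (\<Sum>a\<in>PiE V (\<lambda>_. {..n}). ?s a n)"
      by (rule sum_relabel_invariant)
    also have "\<dots> = (\<Sum>a\<in>?A. ?s a n)"
    proof (rule sum.mono_neutral_right)
      show "finite (PiE V (\<lambda>_. {..n}))" by (simp add: finite_PiE finite_V)
      show "?A \<subseteq> PiE V (\<lambda>_. {..n})" using elim by (intro PiE_mono) auto
      show "\<forall>a\<in>PiE V (\<lambda>_. {..n}) - ?A. ?s a n = 0"
      proof
        fix a assume a: "a \<in> PiE V (\<lambda>_. {..n}) - ?A"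
        then obtain v where v: "v \<in> V" "a v > 2 * M" by (auto simp: PiE_def Pi_def)
        have "f W = 0" if W: "W \<in> configs (\<lambda>v. {..<a v})" for W
        proof (rule ccontr)
          assume "f W \<noteq> 0"
          then have "card W \<le> M" using supp fin[OF W] W by (auto simp: configs_def)
          moreover have "card (fibre W v) = a v" using W v by (simp add: configs_def)
          ultimately show False using card_fibre_le[OF fin[OF W], of v] v(2) by simp
        qed
        then show "?s a n = 0" by simp
      qed
    qed
    finally show ?case .
  qed
  ultimately show ?thesis by (rule inv_power_expansion_from_cong[rotated])
qed

end

section \<open>Families of copies and truncated inclusion-exclusion\<close>

text \<open>\<open>F\<close> abstracts the edge sets of all copies, for all n at once. Finiteness is
  separate from the size bound because \<open>card\<close> is 0 on infinite sets. Connectedness and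
  prunedness are distilled into \<open>ord_less_Un_copy\<close>.\<close>

locale copy_family = fibred_edges +
  fixes F :: "('b \<times> nat \<times> nat) set set" and K :: nat
  assumes finite_copy: "H \<in> F \<Longrightarrow> finite H"
    and card_copy: "H \<in> F \<Longrightarrow> card H \<le> K"
    and empty_not_copy: "{} \<notin> F"
    and relabel_copy: "H \<in> F \<Longrightarrow> (\<And>v. bij (\<pi> v)) \<Longrightarrow> relabel \<pi> ` H \<in> F"
    and ord_less_Un_copy: "H \<in> F \<Longrightarrow> finite W \<Longrightarrow> \<not> H \<subseteq> W \<Longrightarrow> ord W < ord (W \<union> H)"
begin

definition hit :: "('b \<times> nat \<times> nat) set \<Rightarrow> real" where
  "hit Y = of_bool (\<exists>H\<in>F. H \<subseteq> Y)"

text \<open>The Moebius transform of \<open>hit\<close> on the lattice of finite sets.\<close>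

definition mob :: "('b \<times> nat \<times> nat) set \<Rightarrow> real" where
  "mob W = (-1) ^ card W * (\<Sum>Y\<in>Pow W. (-1) ^ card Y * hit Y)"

text \<open>The finite unions of copies, the empty union included, expressed without choosing a list
  of copies.\<close>

definition covered :: "('b \<times> nat \<times> nat) set \<Rightarrow> bool" where
  "covered W \<longleftrightarrow> finite W \<and> W \<subseteq> \<Union>{H \<in> F. H \<subseteq> W}"

lemma hit_eq_sum_mob: "finite S \<Longrightarrow> hit S = (\<Sum>W\<in>Pow S. mob W)"
  unfolding mob_def by (rule inclusion_exclusion_symmetric) auto

lemma abs_mob_le:
  assumes "finite W"
  shows "\<bar>mob W\<bar> \<le> 2 ^ card W"
proof -
  have "\<bar>mob W\<bar> = \<bar>\<Sum>Y\<in>Pow W. (-1) ^ card Y * hit Y\<bar>"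
    by (simp add: mob_def abs_mult power_abs)
  also have "\<dots> \<le> (\<Sum>Y\<in>Pow W. \<bar>(-1) ^ card Y * hit Y\<bar>)"
    by (rule sum_abs)
  also have "\<dots> \<le> (\<Sum>Y\<in>Pow W. 1)"
    by (intro sum_mono) (simp add: hit_def abs_mult power_abs)
  finally show ?thesis by (simp add: card_Pow assms)
qed

text \<open>Toggling an element that lies in no copy inside \<open>W\<close> pairs off the terms of \<open>mob W\<close>.\<close>

lemma mob_eq_0:
  assumes "finite W" "\<not> covered W"
  shows "mob W = 0"
proof -
  obtain x where x: "x \<in> W" "\<And>H. H \<in> F \<Longrightarrow> H \<subseteq> W \<Longrightarrow> x \<notin> H"
    using assms unfolding covered_def by blast
  define V where "V = W - {x}"
  have V: "finite V" "x \<notin> V" "W = insert x V"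
    using x assms by (auto simp: V_def)
  have hit: "hit (insert x Y) = hit Y" if "Y \<subseteq> V" for Y
  proof -
    have "H \<subseteq> insert x Y \<longleftrightarrow> H \<subseteq> Y" if "H \<in> F" for H
      using x(2)[OF that] \<open>Y \<subseteq> V\<close> V(3) by auto
    then show ?thesis unfolding hit_def by (auto cong: bex_cong)
  qed
  have "(\<Sum>Y\<in>Pow W. (-1) ^ card Y * hit Y) = (\<Sum>Y\<in>Pow V. (-1) ^ card Y * hit Y)
      + (\<Sum>Y\<in>insert x ` Pow V. (-1) ^ card Y * hit Y)"
    unfolding V(3) Pow_insert using V by (intro sum.union_disjoint) auto
  also have "(\<Sum>Y\<in>insert x ` Pow V. (-1) ^ card Y * hit Y)
      = (\<Sum>Y\<in>Pow V. (-1) ^ card (insert x Y) * hit (insert x Y))"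
    using V(2) by (subst sum.reindex) (auto simp: inj_on_def)
  also have "\<dots> = (\<Sum>Y\<in>Pow V. - ((-1) ^ card Y * hit Y))"
  proof (rule sum.cong[OF refl])
    fix Y assume "Y \<in> Pow V"
    then have "card (insert x Y) = Suc (card Y)" "Y \<subseteq> V"
      using V finite_subset by (auto intro!: card_insert_disjoint)
    then show "(-1) ^ card (insert x Y) * hit (insert x Y) = - ((-1) ^ card Y * hit Y)"
      by (simp add: hit)
  qed
  finally show ?thesis by (simp add: mob_def sum_negf)
qed

text \<open>The inverse relabelling preserves \<open>F\<close> as well, which yields the second
  inclusion. Invariance of \<open>hit\<close> and \<open>covered\<close> rests on this.\<close>

lemma relabel_copies_subset_eq:
  assumes "\<And>v. bij (\<pi> v)"
  shows "(\<lambda>H. relabel \<pi> ` H) ` {H \<in> F. H \<subseteq> Y} = {H \<in> F. H \<subseteq> relabel \<pi> ` Y}"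
proof (intro equalityI subsetI)
  fix H assume "H \<in> (\<lambda>H. relabel \<pi> ` H) ` {H \<in> F. H \<subseteq> Y}"
  then show "H \<in> {H \<in> F. H \<subseteq> relabel \<pi> ` Y}" using relabel_copy assms by blast
next
  fix H assume H: "H \<in> {H \<in> F. H \<subseteq> relabel \<pi> ` Y}"
  define \<rho> where "\<rho> v = inv (\<pi> v)" for v
  have \<rho>: "bij (\<rho> v)" for v using assms by (simp add: \<rho>_def bij_imp_bij_inv)
  have rel: "relabel \<rho> (relabel \<pi> x) = x" "relabel \<pi> (relabel \<rho> x) = x" for x
    using relabel_inverse[of \<pi>, OF assms] by (simp_all add: \<rho>_def[abs_def])
  have "relabel \<rho> ` H \<subseteq> relabel \<rho> ` relabel \<pi> ` Y" using H by (intro image_mono) auto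
  then have "relabel \<rho> ` H \<subseteq> Y" by (simp add: image_image rel)
  moreover have "relabel \<rho> ` H \<in> F" using H relabel_copy \<rho> by auto
  moreover have "H = relabel \<pi> ` relabel \<rho> ` H" by (simp add: image_image rel)
  ultimately show "H \<in> (\<lambda>H. relabel \<pi> ` H) ` {H \<in> F. H \<subseteq> Y}" by blast
qed

lemma relabel_invariant_hit: "relabel_invariant hit"
  unfolding relabel_invariant_def
proof (intro allI impI)
  fix \<pi> :: "'a \<Rightarrow> nat \<Rightarrow> nat" and W :: "('b \<times> nat \<times> nat) set"
  assume "\<forall>v. bij (\<pi> v)"
  then have "{H \<in> F. H \<subseteq> relabel \<pi> ` W} = {} \<longleftrightarrow> {H \<in> F. H \<subseteq> W} = {}"
    by (simp flip: relabel_copies_subset_eq)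
  then show "hit (relabel \<pi> ` W) = hit W"
    by (auto simp: hit_def)
qed

lemma relabel_invariant_covered: "relabel_invariant covered"
  unfolding relabel_invariant_def
proof (intro allI impI)
  fix \<pi> :: "'a \<Rightarrow> nat \<Rightarrow> nat" and W :: "('b \<times> nat \<times> nat) set"
  assume "\<forall>v. bij (\<pi> v)"
  then have \<pi>: "\<And>v. bij (\<pi> v)" by simp
  have "\<Union>{H \<in> F. H \<subseteq> relabel \<pi> ` W} = relabel \<pi> ` \<Union>{H \<in> F. H \<subseteq> W}"
    unfolding relabel_copies_subset_eq[OF \<pi>, symmetric] by blast
  then show "covered (relabel \<pi> ` W) = covered W"
    using inj_relabel[of \<pi>, OF \<pi>] inj_on_subset[OF inj_relabel[of \<pi>, OF \<pi>], of W]
    by (simp add: covered_def inj_image_subset_iff finite_image_iff)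
qed

lemma relabel_invariant_mob: "relabel_invariant mob"
  unfolding relabel_invariant_def
proof (intro allI impI)
  fix \<pi> :: "'a \<Rightarrow> nat \<Rightarrow> nat" and W :: "('b \<times> nat \<times> nat) set"
  assume \<pi>: "\<forall>v. bij (\<pi> v)"
  have card: "card (relabel \<pi> ` Y) = card Y" and hit: "hit (relabel \<pi> ` Y) = hit Y" for Y
    using \<pi> relabel_invariant_card relabel_invariant_hit by (auto simp: relabel_invariant_def)
  have "inj_on (image (relabel \<pi>)) (Pow W)"
    using \<pi> by (intro inj_on_image_Pow inj_on_subset[OF inj_relabel]) auto
  then have "(\<Sum>Y\<in>Pow (relabel \<pi> ` W). (-1) ^ card Y * hit Y) = (\<Sum>Y\<in>Pow W. (-1) ^ card Y * hit Y)"
    unfolding image_Pow_surj[OF refl, symmetric]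
    by (subst sum.reindex) (auto simp: card hit)
  then show "mob (relabel \<pi> ` W) = mob W"
    by (simp add: mob_def card)
qed

section \<open>Growth of the order along unions of copies\<close>

lemma covered_Un: "covered W \<Longrightarrow> covered Z \<Longrightarrow> covered (W \<union> Z)"
  by (fastforce simp: covered_def)

lemma covered_copy: "H \<in> F \<Longrightarrow> covered H"
  by (auto simp: covered_def finite_copy)

lemma covered_copies: "finite S \<Longrightarrow> covered (\<Union>{H \<in> F. H \<subseteq> S})"
  by (auto simp: covered_def intro: finite_subset[of _ S])

lemma copy_not_subset:
  assumes "covered W" "Z \<subset> W"
  obtains H where "H \<in> F" "H \<subseteq> W" "\<not> H \<subseteq> Z"
  using assms unfolding covered_def by blast

text \<open>\<open>Z\<close> is enlarged by copies inside \<open>W\<close> that it does not yet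
  contain until \<open>W\<close> is reached; every such step raises the order. \<open>Z\<close>
  itself may be any subset.\<close>

lemma ord_less_covered:
  assumes "covered W" "Z \<subset> W"
  shows "ord Z < ord W"
proof -
  have "finite W" using assms(1) by (simp add: covered_def)
  then show ?thesis using assms(2)
  proof (induction "card (W - Z)" arbitrary: Z rule: less_induct)
    case less
    obtain H where H: "H \<in> F" "H \<subseteq> W" "\<not> H \<subseteq> Z"
      using copy_not_subset[OF assms(1) less.prems(2)] .
    have "finite Z" using less.prems finite_subset by blast
    then have "ord Z < ord (Z \<union> H)" using ord_less_Un_copy H by blast
    also have "ord (Z \<union> H) \<le> ord W"
    proof (cases "Z \<union> H = W")
      case False
      have "card (W - (Z \<union> H)) < card (W - Z)"
        using H less.prems by (intro psubset_card_mono) auto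
      then have "ord (Z \<union> H) < ord W"
        using False H less.prems by (intro less.hyps) auto
      then show ?thesis by simp
    qed simp
    finally show ?case .
  qed
qed

text \<open>Greedy growth from the empty set: each added copy costs at most \<open>K\<close> edges
  and gains at least one in order, so after \<open>m\<close> rounds either \<open>W\<close> is
  exhausted or order \<open>m\<close> is reached.\<close>

lemma covered_small_subset:
  assumes "covered W"
  shows "\<exists>Z\<subseteq>W. covered Z \<and> card Z \<le> K * m \<and> (Z = W \<or> int m \<le> ord Z)"
proof (induction m)
  case 0
  show ?case by (rule exI[of _ "{}"]) (auto simp: covered_def ord_def supp_def)
next
  case (Suc m)
  then obtain Z where Z: "Z \<subseteq> W" "covered Z" "card Z \<le> K * m" "Z = W \<or> int m \<le> ord Z" by blast
  show ?case
  proof (cases "Z = W")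
    case True
    with Z show ?thesis by (intro exI[of _ Z]) auto
  next
    case False
    then have "Z \<subset> W" using Z(1) by blast
    then obtain H where H: "H \<in> F" "H \<subseteq> W" "\<not> H \<subseteq> Z"
      using copy_not_subset[OF assms] by blast
    have "finite Z" using Z(2) by (simp add: covered_def)
    then have "ord Z < ord (Z \<union> H)" using ord_less_Un_copy H by blast
    moreover have "card (Z \<union> H) \<le> K * Suc m"
      using card_Un_le[of Z H] Z(3) card_copy[OF H(1)] by simp
    moreover have "covered (Z \<union> H)" by (intro covered_Un covered_copy Z H)
    ultimately show ?thesis using Z H False by (intro exI[of _ "Z \<union> H"]) auto
  qed
qed

section \<open>Truncation at order r\<close>

definition low :: "nat \<Rightarrow> ('b \<times> nat \<times> nat) set \<Rightarrow> bool" where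
  "low r W \<longleftrightarrow> covered W \<and> ord W < int r"

text \<open>The bound \<open>2 * K * r\<close> leaves room for the union of a low set and a greedily
  grown set of order at least \<open>r\<close>, each with at most \<open>K * r\<close>
  edges.\<close>

definition high :: "nat \<Rightarrow> ('b \<times> nat \<times> nat) set \<Rightarrow> bool" where
  "high r W \<longleftrightarrow> covered W \<and> card W \<le> 2 * K * r \<and> int r \<le> ord W"

text \<open>The greedy subset for \<open>m = r\<close> must be all of \<open>W\<close>: a proper one
  would have order at least \<open>r\<close>, exceeding that of \<open>W\<close>, against
  monotonicity.\<close>

lemma low_card_le:
  assumes "low r W"
  shows "card W \<le> K * r"
proof -
  have W: "covered W" "ord W < int r" using assms by (auto simp: low_def)
  obtain Z where Z: "Z \<subseteq> W" "card Z \<le> K * r" "Z = W \<or> int r \<le> ord Z"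
    using covered_small_subset[OF W(1), of r] by blast
  have "Z = W"
    using Z ord_less_covered[OF W(1), of Z] W(2) by force
  then show ?thesis using Z by simp
qed

text \<open>If the union of all copies in \<open>S\<close> has order below \<open>r\<close>, truncation loses nothing. Otherwise \<open>S\<close>
contains some small \<open>Z\<close> of order at least \<open>r\<close>, and \<open>W \<mapsto> W \<union> Z\<close> charges each low term to a high set.\<close>

lemma truncation_error:
  assumes "finite S"
  shows "\<bar>hit S - (\<Sum>W\<in>Pow S. of_bool (low r W) * mob W)\<bar>
       \<le> (1 + 2 ^ (3 * K * r)) * (\<Sum>Z\<in>Pow S. of_bool (high r Z))"
proof -
  define U where "U = \<Union>{H \<in> F. H \<subseteq> S}"
  have U: "covered U" "U \<subseteq> S" using covered_copies[OF assms] by (auto simp: U_def)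
  have sub_U: "W \<subseteq> U" if "covered W" "W \<subseteq> S" for W
    using that by (fastforce simp: covered_def U_def)
  show ?thesis
  proof (cases "ord U < int r")
    \<comment> \<open>Every covered subset of \<open>S\<close> lies in \<open>U\<close>, so its
      order is at most that of \<open>U\<close> and it is low; the remaining subsets have
      \<open>mob\<close> equal to 0.\<close>
    case True
    have "of_bool (low r W) * mob W = mob W" if "W \<in> Pow S" for W
    proof (cases "covered W")
      case True
      then have "ord W \<le> ord U"
        using ord_less_covered[OF U(1), of W] sub_U[of W] that by (cases "W = U") (auto simp: psubset_eq)
      then show ?thesis using True \<open>ord U < int r\<close> by (simp add: low_def)
    next
      case False
      then show ?thesis using mob_eq_0[of W] that assms finite_subset by auto
    qed
    then have "(\<Sum>W\<in>Pow S. of_bool (low r W) * mob W) = hit S"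
      unfolding hit_eq_sum_mob[OF assms] by (intro sum.cong refl)
    then show ?thesis by (simp add: sum_nonneg)
  next
    case False
    obtain Z where Z: "Z \<subseteq> U" "covered Z" "card Z \<le> K * r" "int r \<le> ord Z"
      using covered_small_subset[OF U(1), of r] False by force
    define Q where "Q = {Z \<in> Pow S. high r Z}"
    have finQ: "finite Q" and Q: "(\<Sum>Z\<in>Pow S. of_bool (high r Z)) = real (card Q)"
      using assms by (auto simp: Q_def sum_of_bool_eq Int_def)
    have "Z \<in> Q" using Z U by (auto simp: Q_def high_def)
    then have Q1: "1 \<le> card Q" using finQ by (metis One_nat_def Suc_leI card_gt_0_iff empty_iff)
    define L where "L = {W \<in> Pow S. low r W}"
    \<comment> \<open>A high set has at most 2^(2Kr) subsets, and a low set has \<open>mob\<close>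
      at most 2^(Kr) in absolute value; the product is the constant 2^(3Kr). The extra 1 in the
      claim pays for \<open>hit S\<close>, as \<open>Q\<close> contains \<open>Z\<close>.\<close>
    have "L \<subseteq> \<Union>(Pow ` Q)"
    proof
      fix W assume W: "W \<in> L"
      then have cov: "covered (W \<union> Z)" using Z(2) covered_Un by (auto simp: L_def low_def)
      have "ord Z \<le> ord (W \<union> Z)"
        using ord_less_covered[OF cov, of Z] by (cases "Z = W \<union> Z") (auto simp: psubset_eq)
      moreover have "card (W \<union> Z) \<le> 2 * K * r"
        using card_Un_le[of W Z] Z(3) low_card_le[of r W] W by (auto simp: L_def)
      ultimately have "W \<union> Z \<in> Q"
        using cov Z U W by (auto simp: Q_def high_def L_def)
      then show "W \<in> \<Union>(Pow ` Q)" by blast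
    qed
    moreover have finQQ: "finite Z" if "Z \<in> Q" for Z
      using that by (auto simp: Q_def high_def covered_def)
    ultimately have "card L \<le> card (\<Union>(Pow ` Q))"
      using finQ by (intro card_mono) auto
    also have "\<dots> \<le> (\<Sum>Z\<in>Q. card (Pow Z))"
      by (rule card_UN_le[OF finQ])
    also have "\<dots> \<le> (\<Sum>Z\<in>Q. 2 ^ (2 * K * r))"
      using finQQ by (intro sum_mono) (auto simp: card_Pow Q_def high_def)
    finally have "card L \<le> card Q * 2 ^ (2 * K * r)" by simp
    then have cardL: "real (card L) \<le> real (card Q) * 2 ^ (2 * K * r)"
      by (metis of_nat_le_iff of_nat_mult of_nat_numeral of_nat_power)
    have "(\<Sum>W\<in>Pow S. of_bool (low r W) * mob W) = (\<Sum>W\<in>L. mob W)"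
      using assms by (intro sum.mono_neutral_cong_right) (auto simp: L_def)
    then have "\<bar>\<Sum>W\<in>Pow S. of_bool (low r W) * mob W\<bar> = \<bar>\<Sum>W\<in>L. mob W\<bar>"
      by simp
    also have "\<dots> \<le> (\<Sum>W\<in>L. \<bar>mob W\<bar>)" by (rule sum_abs)
    also have "\<dots> \<le> (\<Sum>W\<in>L. 2 ^ (K * r))"
    proof (rule sum_mono)
      fix W assume "W \<in> L"
      then have "\<bar>mob W\<bar> \<le> 2 ^ card W" "card W \<le> K * r"
        using abs_mob_le low_card_le by (auto simp: L_def low_def covered_def)
      then show "\<bar>mob W\<bar> \<le> 2 ^ (K * r)"
        by (meson one_le_numeral order.trans power_increasing)
    qed
    also have "\<dots> = real (card L) * 2 ^ (K * r)" by simp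
    also have "\<dots> \<le> (real (card Q) * 2 ^ (2 * K * r)) * 2 ^ (K * r)"
      using cardL by (intro mult_right_mono) auto
    also have "\<dots> = real (card Q) * 2 ^ (3 * K * r)"
      by (simp flip: power_add)
    finally have "\<bar>\<Sum>W\<in>Pow S. of_bool (low r W) * mob W\<bar> \<le> real (card Q) * 2 ^ (3 * K * r)" .
    moreover have "\<bar>hit S\<bar> \<le> real (card Q)" using Q1 by (auto simp: hit_def)
    ultimately show ?thesis unfolding Q by (simp add: algebra_simps)
  qed
qed

text \<open>The leading order is 1: the empty set drops out since it is hit by no copy, and a
  nonempty covered set has order above that of the empty set, which is 0.\<close>

lemma mob_low_expansion:
  "inv_power_expansion_from 1
     (\<lambda>n. \<Sum>W\<in>Pow (triples n). (of_bool (low r W) * mob W) * ext_prob n W)"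
proof (rule inv_power_expansion_from_sum_ext_prob)
  show "relabel_invariant (\<lambda>W. of_bool (low r W) * mob W)"
    using relabel_invariant_covered relabel_invariant_ord relabel_invariant_mob
    by (simp add: relabel_invariant_def low_def)
next
  fix W assume W: "finite W" "of_bool (low r W) * mob W \<noteq> 0"
  then have low: "low r W" and mob: "mob W \<noteq> 0" by auto
  have "mob {} = 0" using empty_not_copy by (auto simp: mob_def hit_def)
  then have "{} \<subset> W" using mob by auto
  then have "ord {} < ord W" using low by (intro ord_less_covered) (auto simp: low_def)
  then show "card W \<le> K * r \<and> int 1 \<le> ord W"
    using low_card_le[OF low] by (simp add: ord_def supp_def)
qed

lemma high_expansion:
  "inv_power_expansion_from r
     (\<lambda>n. \<Sum>W\<in>Pow (triples n). of_bool (high r W) * ext_prob n W)"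
proof (rule inv_power_expansion_from_sum_ext_prob[where M = "2 * K * r"])
  show "relabel_invariant (\<lambda>W. of_bool (high r W) :: real)"
    using relabel_invariant_covered relabel_invariant_ord relabel_invariant_card
    by (simp add: relabel_invariant_def high_def)
qed (auto simp: high_def)

text \<open>The random model enters through containment probabilities: linearity turns the average
  of a sum over contained edge sets into a sum weighted by \<open>ext_prob\<close>. This is applied
  both to the low terms and to the high sets that bound the error.\<close>

lemma hit_average_expansion:
  fixes \<Omega> :: "nat \<Rightarrow> 'c set" and \<Gamma> :: "nat \<Rightarrow> 'c \<Rightarrow> ('b \<times> nat \<times> nat) set"
  assumes fin: "\<And>n. finite (\<Omega> n)" and ne: "\<And>n. \<Omega> n \<noteq> {}"
    and \<Gamma>: "\<And>n \<sigma>. \<sigma> \<in> \<Omega> n \<Longrightarrow> \<Gamma> n \<sigma> \<subseteq> triples n"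
    and prob: "\<And>n W. W \<subseteq> triples n \<Longrightarrow>
        real (card {\<sigma> \<in> \<Omega> n. W \<subseteq> \<Gamma> n \<sigma>}) / real (card (\<Omega> n)) = ext_prob n W"
    and "r \<ge> 1"
  shows "\<exists>p :: nat \<Rightarrow> real. (\<lambda>n. (\<Sum>\<sigma>\<in>\<Omega> n. hit (\<Gamma> n \<sigma>)) / real (card (\<Omega> n)) - (\<Sum>k=1..<r. p k / real n ^ k))
           \<in> O(\<lambda>n. 1 / real n ^ r)"
proof -
  define avg where "avg n f = (\<Sum>\<sigma>\<in>\<Omega> n. f (\<Gamma> n \<sigma>)) / real (card (\<Omega> n))"
    for n and f :: "('b \<times> nat \<times> nat) set \<Rightarrow> real"
  have avg_sum: "avg n (\<lambda>S. \<Sum>W\<in>Pow S. f W) = (\<Sum>W\<in>Pow (triples n). f W * ext_prob n W)"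
    for n and f :: "('b \<times> nat \<times> nat) set \<Rightarrow> real"
  proof -
    have "(\<Sum>\<sigma>\<in>\<Omega> n. \<Sum>W\<in>Pow (\<Gamma> n \<sigma>). f W) = (\<Sum>\<sigma>\<in>\<Omega> n. \<Sum>W\<in>{W \<in> Pow (triples n). W \<subseteq> \<Gamma> n \<sigma>}. f W)"
      using \<Gamma> by (intro sum.cong) auto
    also have "\<dots> = (\<Sum>W\<in>Pow (triples n). \<Sum>\<sigma>\<in>{\<sigma> \<in> \<Omega> n. W \<subseteq> \<Gamma> n \<sigma>}. f W)"
      by (rule sum.swap_restrict) (simp_all add: fin finite_triples)
    also have "\<dots> = (\<Sum>W\<in>Pow (triples n). f W * real (card {\<sigma> \<in> \<Omega> n. W \<subseteq> \<Gamma> n \<sigma>}))"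
      by (simp add: mult.commute)
    finally have "avg n (\<lambda>S. \<Sum>W\<in>Pow S. f W)
        = (\<Sum>W\<in>Pow (triples n). f W * (real (card {\<sigma> \<in> \<Omega> n. W \<subseteq> \<Gamma> n \<sigma>}) / real (card (\<Omega> n))))"
      by (simp add: avg_def sum_divide_distrib)
    also have "\<dots> = (\<Sum>W\<in>Pow (triples n). f W * ext_prob n W)"
      using prob by (intro sum.cong) auto
    finally show ?thesis .
  qed
  define main where "main n = (\<Sum>W\<in>Pow (triples n). (of_bool (low r W) * mob W) * ext_prob n W)" for n
  define err where "err n = (\<Sum>W\<in>Pow (triples n). of_bool (high r W) * ext_prob n W)" for n
  have "\<bar>avg n hit - main n\<bar> \<le> (1 + 2 ^ (3 * K * r)) * \<bar>err n\<bar>" for n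
  proof -
    have "\<bar>avg n hit - main n\<bar> =
        \<bar>(\<Sum>\<sigma>\<in>\<Omega> n. hit (\<Gamma> n \<sigma>) - (\<Sum>W\<in>Pow (\<Gamma> n \<sigma>). of_bool (low r W) * mob W)) / real (card (\<Omega> n))\<bar>"
      unfolding main_def avg_sum[symmetric] by (simp add: avg_def sum_subtractf diff_divide_distrib)
    also have "\<dots> \<le> (\<Sum>\<sigma>\<in>\<Omega> n. \<bar>hit (\<Gamma> n \<sigma>) - (\<Sum>W\<in>Pow (\<Gamma> n \<sigma>). of_bool (low r W) * mob W)\<bar>) / real (card (\<Omega> n))"
      unfolding abs_divide by (auto intro!: divide_right_mono sum_abs)
    also have "\<dots> \<le> (\<Sum>\<sigma>\<in>\<Omega> n. (1 + 2 ^ (3 * K * r)) * (\<Sum>Z\<in>Pow (\<Gamma> n \<sigma>). of_bool (high r Z))) / real (card (\<Omega> n))"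
      by (intro divide_right_mono sum_mono truncation_error)
         (auto intro: finite_subset[OF \<Gamma> finite_triples])
    also have "\<dots> = (1 + 2 ^ (3 * K * r)) * err n"
      unfolding err_def avg_sum[symmetric] by (simp add: avg_def flip: sum_distrib_left)
    also have "\<dots> \<le> (1 + 2 ^ (3 * K * r)) * \<bar>err n\<bar>"
      by (intro mult_left_mono) auto
    finally show ?thesis .
  qed
  then have "(\<lambda>n. avg n hit - main n) \<in> O(err)"
    by (intro bigoI[of _ "1 + 2 ^ (3 * K * r)"] always_eventually) auto
  also have "err \<in> O(\<lambda>n. 1 / real n ^ r)"
    unfolding err_def by (rule inv_power_expansion_from_bigo[OF high_expansion])
  finally have error: "(\<lambda>n. avg n hit - main n) \<in> O(\<lambda>n. 1 / real n ^ r)" .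
  obtain g where g: "inv_power_expansion g" "\<forall>\<^sub>F n in sequentially. main n = g n / real n ^ 1"
    using mob_low_expansion[of r] unfolding main_def inv_power_expansion_from_def by blast
  obtain q where q: "(\<lambda>n. g n - poly q (1 / real n)) \<in> O(\<lambda>n. 1 / real n ^ r)"
    using g(1) unfolding inv_power_expansion_def by blast
  \<comment> \<open>Multiplication by the variable matches the factor 1/n in \<open>main\<close>;
    the constant coefficient 0 lets the final sum start at k = 1.\<close>
  define p where "p = pCons 0 q"
  have "(\<lambda>n. (g n - poly q (1 / real n)) * (1 / real n)) \<in> O(\<lambda>n. (1 / real n ^ r) * 1)"
    using inverse_power_bigo[of 0 1 1] by (intro landau_o.big.mult q) simp
  moreover have "\<forall>\<^sub>F n in sequentially. (g n - poly q (1 / real n)) * (1 / real n) = main n - poly p (1 / real n)"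
    using g(2) by eventually_elim (simp add: p_def algebra_simps)
  ultimately have main: "(\<lambda>n. main n - poly p (1 / real n)) \<in> O(\<lambda>n. 1 / real n ^ r)"
    using landau_o.big.in_cong by fastforce
  have "(\<Sum>k<r. coeff p k / real n ^ k) = (\<Sum>k=1..<r. coeff p k / real n ^ k)" for n
    by (rule sum.mono_neutral_right) (auto simp: p_def not_less_eq_eq)
  then have trunc: "(\<lambda>n. poly p (1 / real n) - (\<Sum>k=1..<r. coeff p k / real n ^ k)) \<in> O(\<lambda>n. 1 / real n ^ r)"
    using poly_inverse_truncate[of p r] by simp
  have "(\<lambda>n. avg n hit - (\<Sum>k=1..<r. coeff p k / real n ^ k)) \<in> O(\<lambda>n. 1 / real n ^ r)"
    using sum_in_bigo(1)[OF sum_in_bigo(1)[OF error main] trunc] by simp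
  then show ?thesis unfolding avg_def by blast
qed

end

section \<open>Random covers of an oriented graph\<close>

lemma wf_graph_dart:
  assumes "wf_graph G" "e \<in> darts G"
  shows "tl G e \<in> verts G" "hd G e \<in> verts G" "rev G e \<in> darts G" "rev G (rev G e) = e"
    "rev G e \<noteq> e" "tl G (rev G e) = hd G e" "hd G (rev G e) = tl G e"
proof -
  show *: "tl G e \<in> verts G" "hd G e \<in> verts G" "rev G e \<in> darts G" "rev G (rev G e) = e"
    "rev G e \<noteq> e" "tl G (rev G e) = hd G e"
    using assms by (auto simp: wf_graph_def)
  have "tl G (rev G (rev G e)) = hd G (rev G e)"
    using assms(1) *(3) by (auto simp: wf_graph_def)
  then show "hd G (rev G e) = tl G e" using *(4) by simp
qed

lemma ex_orientation:
  assumes "wf_graph B"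
  shows "\<exists>D\<subseteq>darts B. \<forall>e\<in>darts B. e \<in> D \<longleftrightarrow> rev B e \<notin> D"
proof -
  \<comment> \<open>The choice depends only on the unordered pair, so \<open>e\<close> and its
    reverse select the same dart.\<close>
  define c where "c e = (SOME x. x \<in> {e, rev B e})" for e
  have c: "c e \<in> {e, rev B e}" for e unfolding c_def by (rule someI[of _ e]) simp
  note rev = wf_graph_dart(3-5)[OF assms]
  have "c (rev B e) = c e" if "e \<in> darts B" for e
    by (simp add: c_def rev[OF that] insert_commute disj_commute)
  then have "e \<in> {e \<in> darts B. c e = e} \<longleftrightarrow> rev B e \<notin> {e \<in> darts B. c e = e}"
    if "e \<in> darts B" for e
    using c[of e] rev[OF that] that by auto
  moreover have "{e \<in> darts B. c e = e} \<subseteq> darts B" by blast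
  ultimately show ?thesis by meson
qed

text \<open>\<open>D\<close> holds one dart of each undirected edge; the permutations on
  \<open>D\<close> are free and determine all others.\<close>

locale oriented_graph =
  fixes B :: "('v, 'e) graph" and D :: "'e set"
  assumes wf: "wf_graph B" and D_subset: "D \<subseteq> darts B"
    and D_iff: "e \<in> darts B \<Longrightarrow> e \<in> D \<longleftrightarrow> rev B e \<notin> D"
begin

lemmas B_simps = wf_graph_dart[OF wf]

sublocale fibred_edges "verts B" D "tl B" "hd B"
proof
  show "finite (verts B)" using wf by (simp add: wf_graph_def)
  show "finite D" using wf D_subset by (auto simp: wf_graph_def intro: finite_subset)
qed (use B_simps(1,2) D_subset in blast)+

definition perm_triples :: "nat \<Rightarrow> ('e \<Rightarrow> nat \<Rightarrow> nat) \<Rightarrow> ('e \<times> nat \<times> nat) set" where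
  "perm_triples n \<sigma> = {(e, i, \<sigma> e i) | e i. e \<in> D \<and> i < n}"

lemma perm_triples_subset:
  assumes "\<sigma> \<in> cover_perms B n"
  shows "perm_triples n \<sigma> \<subseteq> triples n"
proof -
  have "\<sigma> e i < n" if "e \<in> D" "i < n" for e i
  proof -
    have "\<sigma> e permutes {..<n}" using assms that(1) D_subset by (auto simp: cover_perms_def)
    from permutes_in_image[OF this, of i] show ?thesis using that(2) by simp
  qed
  then show ?thesis by (auto simp: perm_triples_def triples_def)
qed

lemma subset_perm_triples_iff:
  assumes "W \<subseteq> triples n"
  shows "W \<subseteq> perm_triples n \<sigma> \<longleftrightarrow> (\<forall>e\<in>D. \<forall>(i, j)\<in>over W e. \<sigma> e i = j)"
proof -
  have "(e, i, j) \<in> perm_triples n \<sigma> \<longleftrightarrow> \<sigma> e i = j" if "(e, i, j) \<in> W" for e i j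
    using assms that by (auto simp: perm_triples_def triples_def)
  moreover have D: "e \<in> D" if "(e, i, j) \<in> W" for e i j
    using assms that by (auto simp: triples_def)
  ultimately have "W \<subseteq> perm_triples n \<sigma> \<longleftrightarrow> (\<forall>e i j. (e, i, j) \<in> W \<longrightarrow> e \<in> D \<and> \<sigma> e i = j)"
    by (auto simp: subset_iff)
  also have "\<dots> \<longleftrightarrow> (\<forall>e\<in>D. \<forall>(i, j)\<in>over W e. \<sigma> e i = j)"
    using D by (auto simp: over_def)
  finally show ?thesis .
qed

text \<open>Outside \<open>D\<close> a cover permutation is forced: an inverse on reversed darts,
  the identity off the darts. The constraint \<open>P\<close> lets one bijection count both all
  covers and those containing a given edge set.\<close>

lemma bij_betw_cover_perms:
  "bij_betw (\<lambda>\<sigma>. restrict \<sigma> D)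
     {\<sigma> \<in> cover_perms B n. \<forall>e\<in>D. \<sigma> e \<in> P e}
     (PiE D (\<lambda>e. {p. p permutes {..<n} \<and> p \<in> P e}))"
proof (rule bij_betw_byWitness)
  let ?ext = "\<lambda>\<tau> e. if e \<in> D then \<tau> e else if e \<in> darts B then inv (\<tau> (rev B e)) else id"
  show "\<forall>\<sigma>\<in>{\<sigma> \<in> cover_perms B n. \<forall>e\<in>D. \<sigma> e \<in> P e}. ?ext (restrict \<sigma> D) = \<sigma>"
  proof
    fix \<sigma> assume \<sigma>: "\<sigma> \<in> {\<sigma> \<in> cover_perms B n. \<forall>e\<in>D. \<sigma> e \<in> P e}"
    show "?ext (restrict \<sigma> D) = \<sigma>"
    proof
      fix e
      show "?ext (restrict \<sigma> D) e = \<sigma> e"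
      proof (cases "e \<in> darts B \<and> e \<notin> D")
        case True
        then have "rev B e \<in> D" "rev B e \<in> darts B" using D_iff B_simps by blast+
        moreover from this have "inv (\<sigma> (rev B e)) = \<sigma> (rev B (rev B e))"
          using \<sigma> by (auto simp: cover_perms_def)
        ultimately show ?thesis using True by (simp add: B_simps)
      next
        case False
        then show ?thesis using \<sigma> by (auto simp: cover_perms_def)
      qed
    qed
  qed
  show "\<forall>\<tau>\<in>PiE D (\<lambda>e. {p. p permutes {..<n} \<and> p \<in> P e}). restrict (?ext \<tau>) D = \<tau>"
    by (auto simp: fun_eq_iff PiE_def extensional_def)
  show "(\<lambda>\<sigma>. restrict \<sigma> D) ` {\<sigma> \<in> cover_perms B n. \<forall>e\<in>D. \<sigma> e \<in> P e}
      \<subseteq> PiE D (\<lambda>e. {p. p permutes {..<n} \<and> p \<in> P e})"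
    using D_subset by (auto simp: cover_perms_def)
  show "?ext ` PiE D (\<lambda>e. {p. p permutes {..<n} \<and> p \<in> P e})
      \<subseteq> {\<sigma> \<in> cover_perms B n. \<forall>e\<in>D. \<sigma> e \<in> P e}"
  proof (rule image_subsetI)
    fix \<tau> assume "\<tau> \<in> PiE D (\<lambda>e. {p. p permutes {..<n} \<and> p \<in> P e})"
    then have \<tau>: "\<tau> e permutes {..<n}" "\<tau> e \<in> P e" if "e \<in> D" for e using that by auto
    have "?ext \<tau> e permutes {..<n} \<and> ?ext \<tau> (rev B e) = inv (?ext \<tau> e)" if e: "e \<in> darts B" for e
    proof (cases "e \<in> D")
      case True
      then show ?thesis using D_iff[OF e] B_simps[OF e] \<tau> by simp
    next
      case False
      then have "rev B e \<in> D" using D_iff[OF e] by simp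
      then show ?thesis
        using False B_simps[OF e] e \<tau>(1)[of "rev B e"] by (simp add: permutes_inv permutes_inv_inv)
    qed
    then have "?ext \<tau> \<in> cover_perms B n"
      using D_subset unfolding cover_perms_def by auto
    then show "?ext \<tau> \<in> {\<sigma> \<in> cover_perms B n. \<forall>e\<in>D. \<sigma> e \<in> P e}"
      using \<tau> by simp
  qed
qed

lemma finite_cover_perms: "finite (cover_perms B n)"
proof -
  have "finite (PiE D (\<lambda>e. {p. p permutes {..<n} \<and> p \<in> UNIV}))"
    by (intro finite_PiE finite_E) (simp add: finite_permutations)
  then show ?thesis
    using bij_betw_finite[OF bij_betw_cover_perms[of n "\<lambda>_. UNIV"]] by simp
qed

lemma card_cover_perms:
  "card {\<sigma> \<in> cover_perms B n. \<forall>e\<in>D. \<sigma> e \<in> P e} = (\<Prod>e\<in>D. card {p. p permutes {..<n} \<and> p \<in> P e})"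
  unfolding bij_betw_same_card[OF bij_betw_cover_perms] by (rule card_PiE[OF finite_E])

lemma cover_perms_nonempty: "cover_perms B n \<noteq> {}"
proof -
  have "(\<lambda>_. id) \<in> cover_perms B n" by (simp add: cover_perms_def permutes_id)
  then show ?thesis by blast
qed

lemma prob_subset_perm_triples:
  assumes W: "W \<subseteq> triples n"
  shows "real (card {\<sigma> \<in> cover_perms B n. W \<subseteq> perm_triples n \<sigma>}) / real (card (cover_perms B n))
       = ext_prob n W"
proof -
  let ?P = "\<lambda>e. {p. \<forall>(i, j)\<in>over W e. p i = j}"
  have "card {\<sigma> \<in> cover_perms B n. W \<subseteq> perm_triples n \<sigma>}
      = (\<Prod>e\<in>D. card {p. p permutes {..<n} \<and> (\<forall>(i, j)\<in>over W e. p i = j)})"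
    unfolding subset_perm_triples_iff[OF W] using card_cover_perms[of n ?P] by simp
  moreover have "card (cover_perms B n) = (\<Prod>e\<in>D. fact n)"
    using card_cover_perms[of n "\<lambda>_. UNIV"] by (simp add: card_permutations)
  ultimately have "real (card {\<sigma> \<in> cover_perms B n. W \<subseteq> perm_triples n \<sigma>}) / real (card (cover_perms B n))
      = (\<Prod>e\<in>D. real (card {p. p permutes {..<n} \<and> (\<forall>(i, j)\<in>over W e. p i = j)}) / fact n)"
    by (simp add: prod_dividef)
  also have "\<dots> = ext_prob n W"
  proof (cases "partial_inj W")
    case True
    have "over W e \<subseteq> {..<n} \<times> {..<n}" for e
      using W by (auto simp: over_def triples_def)
    then have "card {p. p permutes {..<n} \<and> (\<forall>(i, j)\<in>over W e. p i = j)} = fact (n - card (over W e))"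
      if "e \<in> D" for e
      using card_permutes_extending[of "{..<n}" "over W e"] True that by (simp add: partial_inj_def)
    then show ?thesis using True by (simp add: ext_prob_def)
  next
    case False
    then obtain e where e: "e \<in> D" "\<not> (inj_on fst (over W e) \<and> inj_on snd (over W e))"
      by (auto simp: partial_inj_def)
    then have "{p. p permutes {..<n} \<and> (\<forall>(i, j)\<in>over W e. p i = j)} = {}"
      using permutes_graph_inj by blast
    then have "card {p. p permutes {..<n} \<and> (\<forall>(i, j)\<in>over W e. p i = j)} = 0"
      by (simp only: card.empty)
    then show ?thesis using False e(1) finite_E by (auto simp: ext_prob_def intro!: prod_zero)
  qed
  finally show ?thesis .
qed

text \<open>\<open>\<phi>\<close> gives the height of each vertex in its fibre; restricting to darts
  over \<open>D\<close> lists each undirected edge once.\<close>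

definition copy_edges :: "('w, 'f) graph \<Rightarrow> ('f \<Rightarrow> 'e) \<Rightarrow> ('w \<Rightarrow> nat) \<Rightarrow> ('e \<times> nat \<times> nat) set" where
  "copy_edges \<psi> pe \<phi> = (\<lambda>d. (pe d, \<phi> (tl \<psi> d), \<phi> (hd \<psi> d))) ` {d \<in> darts \<psi>. pe d \<in> D}"

text \<open>Injectivity on vertices does not suffice: two darts with the same tail and the same
  image in \<open>B\<close> would land on one dart of the cover.\<close>

definition embedding :: "('w, 'f) graph \<Rightarrow> ('w \<Rightarrow> 'v) \<Rightarrow> ('f \<Rightarrow> 'e) \<Rightarrow> ('w \<Rightarrow> nat) \<Rightarrow> bool" where
  "embedding \<psi> pv pe \<phi> \<longleftrightarrow>
     inj_on (\<lambda>v. (pv v, \<phi> v)) (verts \<psi>) \<and> inj_on (\<lambda>d. (pe d, \<phi> (tl \<psi> d))) (darts \<psi>)"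

end

section \<open>Copies of a pruned connected graph\<close>

locale oriented_B_graph = oriented_graph B D
  for B :: "('v, 'e) graph" and D +
  fixes \<psi> :: "('w, 'f) graph" and pv :: "'w \<Rightarrow> 'v" and pe :: "'f \<Rightarrow> 'e"
  assumes B_graph: "is_B_graph B \<psi> pv pe"
begin

lemma wf_\<psi>: "wf_graph \<psi>"
  using B_graph by (simp add: is_B_graph_def)

lemma morphism_dart:
  assumes "d \<in> darts \<psi>"
  shows "pe d \<in> darts B" "tl B (pe d) = pv (tl \<psi> d)" "hd B (pe d) = pv (hd \<psi> d)"
    "pe (rev \<psi> d) = rev B (pe d)"
  using B_graph assms unfolding is_B_graph_def graph_morphism_def by simp_all

lemmas \<psi>_simps = wf_graph_dart[OF wf_\<psi>] morphism_dart

lemma finite_\<psi>: "finite (verts \<psi>)" "finite (darts \<psi>)"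
  using B_graph by (auto simp: is_B_graph_def wf_graph_def)

lemma rev_in_D_iff: "d \<in> darts \<psi> \<Longrightarrow> pe (rev \<psi> d) \<in> D \<longleftrightarrow> pe d \<notin> D"
  using D_iff[of "pe d"] by (simp add: \<psi>_simps)

lemma copy_edges_nonempty:
  assumes "graph_ord \<psi> \<ge> 1"
  shows "copy_edges \<psi> pe \<phi> \<noteq> {}"
proof -
  obtain d where "d \<in> darts \<psi>" using assms by (fastforce simp: graph_ord_def)
  then have "\<exists>d\<in>darts \<psi>. pe d \<in> D" using rev_in_D_iff[of d] \<psi>_simps(3)[of d] by blast
  then show ?thesis by (auto simp: copy_edges_def)
qed

lemma relabel_copy_edges:
  "relabel \<pi> ` copy_edges \<psi> pe \<phi> = copy_edges \<psi> pe (\<lambda>v. \<pi> (pv v) (\<phi> v))"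
  unfolding copy_edges_def image_image by (intro image_cong) (auto simp: relabel_def \<psi>_simps)

lemma embedding_relabel:
  assumes "embedding \<psi> pv pe \<phi>" "\<And>v. bij (\<pi> v)"
  shows "embedding \<psi> pv pe (\<lambda>v. \<pi> (pv v) (\<phi> v))"
proof -
  have \<pi>: "\<pi> v i = \<pi> v j \<longleftrightarrow> i = j" for v i j
    using assms(2)[of v] by (simp add: bij_def inj_eq)
  \<comment> \<open>Darts with equal image in \<open>B\<close> have tails in the same fibre, where
    one bijection acts.\<close>
  have "\<phi> (tl \<psi> d) = \<phi> (tl \<psi> d')"
    if "d \<in> darts \<psi>" "d' \<in> darts \<psi>" "pe d = pe d'"
      "\<pi> (pv (tl \<psi> d)) (\<phi> (tl \<psi> d)) = \<pi> (pv (tl \<psi> d')) (\<phi> (tl \<psi> d'))" for d d'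
    using that \<psi>_simps(9)[of d] \<psi>_simps(9)[of d'] by (simp add: \<pi>)
  then show ?thesis
    using assms(1) by (auto simp: embedding_def inj_on_def \<pi>)
qed

text \<open>Each new vertex has degree at least two and all its edges are new, so at least as many edges as
vertices are added. Equality would make the new part a union of cycles closed under adjacency, so by
connectedness all of \<open>\<psi>\<close> would be a cycle, of order zero.\<close>

lemma ord_less_Un_copy_edges:
  assumes conn: "connected_graph \<psi>" and pruned: "pruned \<psi>" and ord1: "graph_ord \<psi> \<ge> 1"
    and emb: "embedding \<psi> pv pe \<phi>" and W: "finite W" "\<not> copy_edges \<psi> pe \<phi> \<subseteq> W"
  shows "ord W < ord (W \<union> copy_edges \<psi> pe \<phi>)"
proof -
  define H where "H = copy_edges \<psi> pe \<phi>"
  \<comment> \<open>The triple of the undirected edge of \<open>d\<close>, the same for both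
    directions.\<close>
  define tr where "tr d = (if pe d \<in> D then (pe d, \<phi> (tl \<psi> d), \<phi> (hd \<psi> d))
    else (rev B (pe d), \<phi> (hd \<psi> d), \<phi> (tl \<psi> d)))" for d
  have tr_rev: "tr (rev \<psi> d) = tr d" if "d \<in> darts \<psi>" for d
    using that rev_in_D_iff[OF that] by (simp add: tr_def \<psi>_simps B_simps)
  have H: "H = tr ` {d \<in> darts \<psi>. pe d \<in> D}"
    by (auto simp: H_def copy_edges_def tr_def intro!: image_cong)
  have finH: "finite H" by (simp add: H finite_\<psi>)
  define N where "N = {d \<in> darts \<psi>. tr d \<notin> W}"
  define N' where "N' = {d \<in> N. pe d \<in> D}"
  have finN: "finite N" "finite N'" using finite_\<psi> by (auto simp: N_def N'_def)
  have N_rev: "rev \<psi> d \<in> N" if "d \<in> N" for d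
    using that by (auto simp: N_def \<psi>_simps tr_rev)
  have "inj_on tr {d \<in> darts \<psi>. pe d \<in> D}"
    using emb by (auto simp: embedding_def inj_on_def tr_def)
  then have "inj_on tr N'" by (rule inj_on_subset) (auto simp: N'_def N_def)
  moreover have HW: "tr ` N' = H - W" by (auto simp: N'_def N_def H)
  ultimately have card_HW: "card (H - W) = card N'" using card_image by metis
  have "N = N' \<union> rev \<psi> ` N'"
  proof (intro equalityI subsetI)
    fix d assume d: "d \<in> N"
    then have "d \<in> darts \<psi>" by (simp add: N_def)
    then have "d = rev \<psi> (rev \<psi> d)" "pe d \<notin> D \<longrightarrow> pe (rev \<psi> d) \<in> D"
      using rev_in_D_iff by (auto simp: \<psi>_simps)
    then show "d \<in> N' \<union> rev \<psi> ` N'"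
      using d N_rev[OF d] unfolding N'_def by blast
  qed (auto simp: N'_def N_rev)
  moreover have "N' \<inter> rev \<psi> ` N' = {}"
    using rev_in_D_iff by (auto simp: N'_def N_def)
  moreover have "inj_on (rev \<psi>) N'"
    by (rule inj_on_inverseI[of _ "rev \<psi>"]) (auto simp: N'_def N_def \<psi>_simps)
  ultimately have card_N: "card N = 2 * card N'"
    using card_Un_disjoint[of N' "rev \<psi> ` N'"] finN by (simp add: card_image)
  define A where "A = {v \<in> verts \<psi>. (pv v, \<phi> v) \<notin> supp W}"
  have finA: "finite A" using finite_\<psi> by (simp add: A_def)
  have tr_supp: "(pv (tl \<psi> d), \<phi> (tl \<psi> d)) \<in> supp W" "(pv (hd \<psi> d), \<phi> (hd \<psi> d)) \<in> supp W"
    if "d \<in> darts \<psi>" "tr d \<in> W" for d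
    using that by (auto simp: tr_def \<psi>_simps B_simps split: if_splits dest: supp_memI)
  \<comment> \<open>Darts leaving the new vertices \<open>A\<close> belong to new edges, so the
    degree bound gives 2|A| \<le> |T| \<le> |N| = 2|N'|.\<close>
  define T where "T = {d \<in> darts \<psi>. tl \<psi> d \<in> A}"
  have "T \<subseteq> N" using tr_supp by (auto simp: T_def N_def A_def)
  have "T = (\<Union>v\<in>A. {d \<in> darts \<psi>. tl \<psi> d = v})" by (auto simp: T_def)
  then have card_T: "card T = (\<Sum>v\<in>A. degree \<psi> v)"
    using finA finite_\<psi> by (auto simp: degree_def intro: card_UN_disjoint)
  have "2 * card A = (\<Sum>v\<in>A. 2)" by simp
  also have "\<dots> \<le> card T"
    unfolding card_T using pruned by (intro sum_mono) (auto simp: pruned_def A_def)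
  finally have A_le_T: "2 * card A \<le> card T" .
  have T_le_N: "card T \<le> card N" using \<open>T \<subseteq> N\<close> finN by (intro card_mono)
  have "card A < card N'"
  proof (rule ccontr)
    \<comment> \<open>The chain becomes equality, so \<open>T = N\<close> is closed under reversal
      and \<open>A\<close> under adjacency. Connectedness spreads \<open>A\<close> over all
      vertices, whence |darts| = 2|vertices|, that is, order 0.\<close>
    assume "\<not> card A < card N'"
    then have "card T = card N" "card T = 2 * card A" using A_le_T T_le_N card_N by auto
    then have "T = N" using card_subset_eq[OF finN(1) \<open>T \<subseteq> N\<close>] by simp
    have A_step: "hd \<psi> d \<in> A" if "d \<in> darts \<psi>" "tl \<psi> d \<in> A" for d
    proof -
      have "d \<in> N" using that \<open>T \<subseteq> N\<close> by (auto simp: T_def)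
      then have "rev \<psi> d \<in> T" using N_rev \<open>T = N\<close> by simp
      then show ?thesis using that by (simp add: T_def \<psi>_simps)
    qed
    have "N' \<noteq> {}" using W(2) HW by (auto simp: H_def)
    then obtain d where "d \<in> T" using \<open>T = N\<close> by (auto simp: N'_def)
    then have u: "tl \<psi> d \<in> A" by (simp add: T_def)
    have "v \<in> A" if "v \<in> verts \<psi>" for v
    proof -
      have "(tl \<psi> d, v) \<in> {(tl \<psi> e, hd \<psi> e) | e. e \<in> darts \<psi>}\<^sup>*"
        using conn that u by (auto simp: connected_graph_def A_def)
      then show ?thesis
        by (induction rule: rtrancl_induct) (use u A_step in auto)
    qed
    then have "A = verts \<psi>" by (auto simp: A_def)
    then have "T = darts \<psi>" by (auto simp: T_def \<psi>_simps)
    then show False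
      using \<open>card T = 2 * card A\<close> \<open>A = verts \<psi>\<close> ord1 by (simp add: graph_ord_def)
  qed
  moreover have "card (supp H - supp W) \<le> card A"
  proof -
    have "supp H \<subseteq> (\<lambda>v. (pv v, \<phi> v)) ` verts \<psi>"
      by (auto simp: supp_def H tr_def \<psi>_simps)
    then have "supp H - supp W \<subseteq> (\<lambda>v. (pv v, \<phi> v)) ` A"
      by (auto simp: A_def)
    then show ?thesis
      using finA by (meson card_image_le card_mono finite_imageI order.trans)
  qed
  moreover have "card (W \<union> H) = card W + card (H - W)"
    using W(1) finH by (metis Diff_disjoint Un_Diff_cancel card_Un_disjoint finite_Diff)
  moreover have "card (supp (W \<union> H)) = card (supp W) + card (supp H - supp W)"
  proof -
    have "supp (W \<union> H) = supp W \<union> supp H" by (simp add: supp_def image_Un Un_ac)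
    then show ?thesis
      using finite_supp[OF W(1)] finite_supp[OF finH]
      by (metis Diff_disjoint Un_Diff_cancel card_Un_disjoint finite_Diff)
  qed
  ultimately show ?thesis
    unfolding ord_def H_def[symmetric] using card_HW by simp
qed

text \<open>Compatibility with the maps to \<open>B\<close> fixes the first coordinates, and a dart
  of the cover is determined by its image in \<open>B\<close> and its tail. An isomorphism onto a
  subgraph therefore amounts to a choice of heights \<open>\<phi>\<close>.\<close>

lemma ex_subgraph_iff:
  assumes \<sigma>: "\<sigma> \<in> cover_perms B n" and pruned: "pruned \<psi>"
  shows "(\<exists>H. subgraph H (cover_graph B n \<sigma>) \<and> B_graph_iso \<psi> pv pe H fst fst)
     \<longleftrightarrow> (\<exists>\<phi>. embedding \<psi> pv pe \<phi> \<and> copy_edges \<psi> pe \<phi> \<subseteq> perm_triples n \<sigma>)"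
proof
  let ?G = "cover_graph B n \<sigma>"
  assume "\<exists>H. subgraph H ?G \<and> B_graph_iso \<psi> pv pe H fst fst"
  then obtain H fv fe where sub: "subgraph H ?G"
    and bij: "bij_betw fv (verts \<psi>) (verts H)" "bij_betw fe (darts \<psi>) (darts H)"
    and mor: "graph_morphism \<psi> H fv fe"
    and fst: "\<And>v. v \<in> verts \<psi> \<Longrightarrow> fst (fv v) = pv v" "\<And>d. d \<in> darts \<psi> \<Longrightarrow> fst (fe d) = pe d"
    unfolding B_graph_iso_def by blast
  define \<phi> where "\<phi> v = snd (fv v)" for v
  have fv: "fv v = (pv v, \<phi> v)" if "v \<in> verts \<psi>" for v
    using fst(1)[OF that] by (simp add: \<phi>_def prod_eq_iff)
  have fe: "fe d = (pe d, \<phi> (tl \<psi> d)) \<and> \<phi> (tl \<psi> d) < n \<and> \<sigma> (pe d) (\<phi> (tl \<psi> d)) = \<phi> (hd \<psi> d)"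
    if d: "d \<in> darts \<psi>" for d
  proof -
    obtain i where i: "fe d = (pe d, i)" using fst(2)[OF d] by (metis prod.collapse)
    have "fe d \<in> darts H" using bij(2) d by (auto simp: bij_betw_def)
    then have G: "fe d \<in> darts ?G" "tl H (fe d) = tl ?G (fe d)" "hd H (fe d) = hd ?G (fe d)"
      using sub by (auto simp: subgraph_def)
    have "tl H (fe d) = fv (tl \<psi> d)" "hd H (fe d) = fv (hd \<psi> d)"
      using mor d by (auto simp: graph_morphism_def)
    with G i show ?thesis
      by (simp add: cover_graph_def fv \<psi>_simps[OF d])
  qed
  have "inj_on (\<lambda>v. (pv v, \<phi> v)) (verts \<psi>)"
    using bij(1) fv by (simp add: bij_betw_def cong: inj_on_cong)
  moreover have "inj_on (\<lambda>d. (pe d, \<phi> (tl \<psi> d))) (darts \<psi>)"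
    using bij(2) fe by (simp add: bij_betw_def cong: inj_on_cong)
  ultimately have "embedding \<psi> pv pe \<phi>" by (simp add: embedding_def)
  moreover have "copy_edges \<psi> pe \<phi> \<subseteq> perm_triples n \<sigma>"
    using fe by (force simp: copy_edges_def perm_triples_def)
  ultimately show "\<exists>\<phi>. embedding \<psi> pv pe \<phi> \<and> copy_edges \<psi> pe \<phi> \<subseteq> perm_triples n \<sigma>" by blast
next
  let ?G = "cover_graph B n \<sigma>"
  assume "\<exists>\<phi>. embedding \<psi> pv pe \<phi> \<and> copy_edges \<psi> pe \<phi> \<subseteq> perm_triples n \<sigma>"
  then obtain \<phi> where emb: "embedding \<psi> pv pe \<phi>"
    and sub: "copy_edges \<psi> pe \<phi> \<subseteq> perm_triples n \<sigma>" by blast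
  have pos: "\<sigma> (pe d) (\<phi> (tl \<psi> d)) = \<phi> (hd \<psi> d) \<and> \<phi> (tl \<psi> d) < n" if "d \<in> darts \<psi>" "pe d \<in> D" for d
    using sub that by (auto simp: copy_edges_def perm_triples_def)
  \<comment> \<open>A dart not over \<open>D\<close> is handled through its reverse and the inverse
    permutation.\<close>
  have all: "\<sigma> (pe d) (\<phi> (tl \<psi> d)) = \<phi> (hd \<psi> d) \<and> \<phi> (tl \<psi> d) < n" if d: "d \<in> darts \<psi>" for d
  proof (cases "pe d \<in> D")
    case True
    then show ?thesis using pos d by blast
  next
    case False
    have perm: "\<sigma> (pe d) permutes {..<n}" and inv: "\<sigma> (rev B (pe d)) = inv (\<sigma> (pe d))"
      using \<sigma> \<psi>_simps(8)[OF d] by (auto simp: cover_perms_def)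
    have "\<sigma> (pe (rev \<psi> d)) (\<phi> (tl \<psi> (rev \<psi> d))) = \<phi> (hd \<psi> (rev \<psi> d)) \<and> \<phi> (tl \<psi> (rev \<psi> d)) < n"
      using False d rev_in_D_iff[OF d] by (intro pos) (simp_all add: \<psi>_simps(3))
    then have *: "inv (\<sigma> (pe d)) (\<phi> (hd \<psi> d)) = \<phi> (tl \<psi> d)" "\<phi> (hd \<psi> d) < n"
      using d inv by (auto simp: \<psi>_simps)
    have "\<phi> (tl \<psi> d) < n"
      using permutes_in_image[OF permutes_inv[OF perm], of "\<phi> (hd \<psi> d)"] * by simp
    then show ?thesis using *(1) perm by (metis permutes_inverses(1))
  qed
  \<comment> \<open>Prunedness makes every vertex the tail of some dart, and darts constrain the
    heights.\<close>
  have \<phi>_less: "\<phi> v < n" if "v \<in> verts \<psi>" for v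
  proof -
    have "degree \<psi> v \<noteq> 0" using pruned that by (fastforce simp: pruned_def)
    then obtain d where "d \<in> darts \<psi>" "tl \<psi> d = v"
      unfolding degree_def by (metis (mono_tags, lifting) card.empty empty_Collect_eq)
    then show ?thesis using all by blast
  qed
  let ?nv = "\<lambda>v. (pv v, \<phi> v)" and ?nd = "\<lambda>d. (pe d, \<phi> (tl \<psi> d))"
  define H where "H = \<lparr>verts = ?nv ` verts \<psi>, darts = ?nd ` darts \<psi>, tl = tl ?G, hd = hd ?G, rev = rev ?G\<rparr>"
  have H_simps: "verts H = ?nv ` verts \<psi>" "darts H = ?nd ` darts \<psi>"
    "tl H = tl ?G" "hd H = hd ?G" "rev H = rev ?G"
    by (simp_all add: H_def)
  have G: "tl ?G (?nd d) = ?nv (tl \<psi> d)" "hd ?G (?nd d) = ?nv (hd \<psi> d)" "rev ?G (?nd d) = ?nd (rev \<psi> d)"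
    if "d \<in> darts \<psi>" for d
    using that all[OF that] by (simp_all add: cover_graph_def \<psi>_simps)
  have inj: "inj_on ?nv (verts \<psi>)" "inj_on ?nd (darts \<psi>)"
    using emb by (auto simp: embedding_def)
  have "wf_graph H"
    unfolding wf_graph_def
  proof (intro conjI ballI)
    fix e assume "e \<in> darts H"
    then obtain d where d: "d \<in> darts \<psi>" "e = ?nd d" by (auto simp: H_simps)
    note d' = \<psi>_simps(3)[OF d(1)]
    have e: "tl H e = ?nv (tl \<psi> d)" "hd H e = ?nv (hd \<psi> d)" "rev H e = ?nd (rev \<psi> d)"
      using G[OF d(1)] by (simp_all only: H_simps d(2))
    show "tl H e \<in> verts H" "hd H e \<in> verts H" "rev H e \<in> darts H"
      unfolding e unfolding H_simps using d' \<psi>_simps(1,2)[OF d(1)] by blast+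
    show "rev H (rev H e) = e" "tl H (rev H e) = hd H e"
      unfolding e unfolding H_simps G[OF d'] by (simp_all add: d \<psi>_simps(4,6)[OF d(1)])
    show "rev H e \<noteq> e"
      unfolding e unfolding d(2) using inj_onD[OF inj(2) _ d' d(1)] \<psi>_simps(5)[OF d(1)] by blast
  qed (simp_all add: H_simps finite_\<psi>)
  moreover have "verts H \<subseteq> verts ?G" "darts H \<subseteq> darts ?G"
    using B_graph all \<phi>_less
    by (auto simp: H_simps cover_graph_def is_B_graph_def graph_morphism_def)
  ultimately have "subgraph H ?G" by (simp add: subgraph_def H_simps)
  moreover have "B_graph_iso \<psi> pv pe H fst fst"
    unfolding B_graph_iso_def
  proof (intro exI conjI)
    show "bij_betw ?nv (verts \<psi>) (verts H)" "bij_betw ?nd (darts \<psi>) (darts H)"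
      using inj by (auto simp: bij_betw_def H_simps)
    show "graph_morphism \<psi> H ?nv ?nd"
      unfolding graph_morphism_def by (simp add: H_simps G)
  qed auto
  ultimately show "\<exists>H. subgraph H ?G \<and> B_graph_iso \<psi> pv pe H fst fst" by blast
qed

end

theorem theorem2p80:
  fixes B :: "('bv, 'be) graph"
    and Psi :: "(('v, 'e) graph \<times> ('v \<Rightarrow> 'bv) \<times> ('e \<Rightarrow> 'be)) set"
  assumes "wf_graph B" and "connected_graph B" and "graph_ord B > 0"
    and "finite Psi"
    and "\<forall>(\<psi>, pv, pe)\<in>Psi. is_B_graph B \<psi> pv pe \<and> connected_graph \<psi> \<and> pruned \<psi>
                            \<and> graph_ord \<psi> \<ge> 1"
  shows "\<forall>r::nat. r \<ge> 1 \<longrightarrow> (\<exists>p :: nat \<Rightarrow> real.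
           (\<lambda>n. expected_Psi B Psi n - (\<Sum>k=1..<r. p k / real n ^ k))
             \<in> O(\<lambda>n. 1 / real n ^ r))"
proof (intro allI impI)
  fix r :: nat assume r: "r \<ge> 1"
  obtain D where "D \<subseteq> darts B" "\<forall>e\<in>darts B. e \<in> D \<longleftrightarrow> rev B e \<notin> D"
    using ex_orientation[OF assms(1)] by blast
  then interpret oriented_graph B D
    using assms(1) by unfold_locales auto
  have Psi: "oriented_B_graph B D \<psi> pv pe" "connected_graph \<psi>" "pruned \<psi>" "graph_ord \<psi> \<ge> 1"
    if "(\<psi>, pv, pe) \<in> Psi" for \<psi> pv pe
    using assms(5) that by (auto intro!: oriented_B_graph.intro oriented_graph_axioms oriented_B_graph_axioms.intro)
  \<comment> \<open>Heights are unrestricted, so one family serves every n; containment in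
    \<open>perm_triples n \<sigma>\<close> later selects the copies present in a cover.\<close>
  define F where "F = {copy_edges \<psi> pe \<phi> | \<psi> pv pe \<phi>. (\<psi>, pv, pe) \<in> Psi \<and> embedding \<psi> pv pe \<phi>}"
  \<comment> \<open>A crude common bound on the size of a copy; a sum, unlike a maximum, is harmless
    for empty \<open>Psi\<close>.\<close>
  define K where "K = (\<Sum>x\<in>Psi. card (darts (fst x)))"
  interpret copy_family "verts B" D "tl B" "hd B" F K
  proof unfold_locales
    fix H assume "H \<in> F"
    then obtain \<psi> pv pe \<phi> where \<psi>: "(\<psi>, pv, pe) \<in> Psi" "embedding \<psi> pv pe \<phi>"
      and H: "H = copy_edges \<psi> pe \<phi>" by (auto simp: F_def)
    interpret oriented_B_graph B D \<psi> pv pe by (rule Psi(1)[OF \<psi>(1)])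
    show "finite H" by (simp add: H copy_edges_def finite_\<psi>)
    have "card H \<le> card {d \<in> darts \<psi>. pe d \<in> D}"
      unfolding H copy_edges_def by (intro card_image_le) (simp add: finite_\<psi>)
    also have "\<dots> \<le> card (darts \<psi>)" by (intro card_mono finite_\<psi>) auto
    also have "\<dots> \<le> K"
      unfolding K_def using member_le_sum[OF \<psi>(1), of "\<lambda>x. card (darts (fst x))"] assms(4) by simp
    finally show "card H \<le> K" .
    show "relabel \<pi> ` H \<in> F" if "\<And>v. bij (\<pi> v)" for \<pi>
      unfolding H relabel_copy_edges F_def using \<psi> embedding_relabel[of \<phi> \<pi>, OF \<psi>(2) that] by blast
    show "ord W < ord (W \<union> H)" if "finite W" "\<not> H \<subseteq> W" for W
      unfolding H by (rule ord_less_Un_copy_edges) (use Psi[OF \<psi>(1)] \<psi>(2) that H in auto)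
  next
    show "{} \<notin> F"
      unfolding F_def using oriented_B_graph.copy_edges_nonempty[OF Psi(1) Psi(4)] by blast
  qed
  have "indicator_Psi Psi (cover_graph B n \<sigma>) fst fst = hit (perm_triples n \<sigma>)"
    if \<sigma>: "\<sigma> \<in> cover_perms B n" for n \<sigma>
  proof -
    have "(\<exists>H. subgraph H (cover_graph B n \<sigma>) \<and> B_graph_iso (fst x) (fst (snd x)) (snd (snd x)) H fst fst)
        \<longleftrightarrow> (\<exists>\<phi>. embedding (fst x) (fst (snd x)) (snd (snd x)) \<phi>
              \<and> copy_edges (fst x) (snd (snd x)) \<phi> \<subseteq> perm_triples n \<sigma>)" if "x \<in> Psi" for x
      using oriented_B_graph.ex_subgraph_iff[OF Psi(1) \<sigma> Psi(3)] that by (cases x) simp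
    then have "has_Psi_copy Psi (cover_graph B n \<sigma>) fst fst \<longleftrightarrow> (\<exists>(\<psi>, pv, pe)\<in>Psi.
        \<exists>\<phi>. embedding \<psi> pv pe \<phi> \<and> copy_edges \<psi> pe \<phi> \<subseteq> perm_triples n \<sigma>)"
      unfolding has_Psi_copy_def case_prod_unfold by (intro bex_cong refl)
    also have "\<dots> \<longleftrightarrow> (\<exists>H\<in>F. H \<subseteq> perm_triples n \<sigma>)"
      by (fastforce simp: F_def)
    finally show ?thesis by (simp add: indicator_Psi_def hit_def)
  qed
  then have "expected_Psi B Psi n
      = (\<Sum>\<sigma>\<in>cover_perms B n. hit (perm_triples n \<sigma>)) / real (card (cover_perms B n))" for n
    by (simp add: expected_Psi_def integral_pmf_of_set[OF cover_perms_nonempty finite_cover_perms])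
  then show "\<exists>p :: nat \<Rightarrow> real. (\<lambda>n. expected_Psi B Psi n - (\<Sum>k=1..<r. p k / real n ^ k))
      \<in> O(\<lambda>n. 1 / real n ^ r)"
    using hit_average_expansion[OF finite_cover_perms cover_perms_nonempty perm_triples_subset
        prob_subset_perm_triples r] by simp
qed

end
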